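(* Let $k$ be a positive integer, $p$ a prime, $n=p^k$ and $n_0=p^{k+1}$. Then an integral basis of the pure fields $\mathbb{Q}(\sqrt[n]{m})$, where $m\neq\pm1$ ranges over square-free integers, is repeating periodically modulo $n_0$.
   Context: For an integer $n\geq2$ and a square-free integer $m\neq\pm1$, let $\alpha_m$ be a root of $X^n-m$ and $K_m=\mathbb{Q}(\alpha_m)$ (a field of degree $n$). An integral basis of the fields $K_m$ is said to be repeating periodically modulo $n_0$ if for each residue class $r$ modulo $n_0$ there exist polynomials $h^{(r)}_0(X),\ldots,h^{(r)}_{n-1}(X)\in\mathbb{Q}[X]$ such that whenever $m$ is square-free, $m\neq\pm1$, and $m\equiv r \pmod{n_0}$, the tuple $(h^{(r)}_0(\alpha_m),\ldots,h^{(r)}_{n-1}(\alpha_m))$ is an integral basis (a $\mathbb{Z}$-basis of the ring of integers) of $K_m$. *)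

theory Defs
  imports "HOL-Computational_Algebra.Computational_Algebra" "HOL-Number_Theory.Number_Theory"
begin

definition gen_field :: "complex \<Rightarrow> complex set" where
  "gen_field \<alpha> = {poly (map_poly of_rat q) \<alpha> | q :: rat poly. True}"

definition ring_of_integers :: "complex \<Rightarrow> complex set" where
  "ring_of_integers \<alpha> = {x \<in> gen_field \<alpha>. algebraic_int x}"

definition is_integral_basis :: "complex \<Rightarrow> nat \<Rightarrow> (nat \<Rightarrow> complex) \<Rightarrow> bool" where
  "is_integral_basis \<alpha> n b \<longleftrightarrow>
     ring_of_integers \<alpha> = {(\<Sum>i<n. of_int (c i) * b i) | c :: nat \<Rightarrow> int. True} \<and>
     (\<forall>c :: nat \<Rightarrow> int. (\<Sum>i<n. of_int (c i) * b i) = 0 \<longrightarrow> (\<forall>i<n. c i = 0))"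

definition integral_basis_periodic :: "nat \<Rightarrow> nat \<Rightarrow> bool" where
  "integral_basis_periodic n n0 \<longleftrightarrow>
     (\<forall>r :: int. \<exists>h :: nat \<Rightarrow> rat poly.
        \<forall>m :: int. squarefree m \<and> m \<noteq> 1 \<and> m \<noteq> -1 \<and> [m = r] (mod int n0) \<longrightarrow>
          (\<forall>\<alpha> :: complex. \<alpha> ^ n = of_int m \<longrightarrow>
             is_integral_basis \<alpha> n (\<lambda>i. poly (map_poly of_rat (h i)) \<alpha>)))"

end

theory Submission
  imports Defs
begin

text \<open>
  Write \<open>n = p ^ k\<close> and \<open>\<alpha> ^ n = m\<close>. The trace form and the Eisenstein primes dividing \<open>m\<close> show that
  \<open>n\<close> times any integer of \<open>\<rat>(\<alpha>)\<close> lies in \<open>\<int>[\<alpha>]\<close>, so only the prime \<open>p\<close> matters, and if \<open>p\<close> divides \<open>m\<close>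
  the powers of \<open>\<alpha>\<close> form an integral basis. Otherwise put \<open>c = r\<close> and consider the Newton polygon of
  \<open>(X + c) ^ n - m\<close> at \<open>p\<close>: all sides beyond the first have height one, and for \<open>p = 2\<close> the first two
  sides may have the same slope. By Ore's theory a basis is given by quotients of \<open>X ^ n - m\<close> by powers of \<open>X - c\<close>,
  divided by powers of \<open>p\<close> read off the polygon. Since the polygon matters only up to height \<open>k + 1\<close>, these depend on \<open>m\<close> only
  through its residue modulo \<open>p ^ (k + 1)\<close>.

  Ore's theorem is replaced by an evaluation argument: if an integer combination of the basis elements is
  divisible by \<open>p\<close> in the ring of integers, then evaluating it at a root \<open>x\<close> on each side, where
  \<open>x - c\<close> has valuation \<open>1 / e\<close>, forces the coefficients to be divisible by \<open>p\<close>, because the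
  valuations of the contributing terms are distinct modulo \<open>1\<close>. The valuation on \<open>\<complex>\<close> comes from
  extending \<open>\<int>\<close> to a valuation ring by Zorn's lemma.
\<close>

text \<open>The lower hull of the polygon passes through \<open>(0, w)\<close>, where
  \<open>w\<close> is the valuation of \<open>m - c ^ n\<close>, and through
  \<open>(p ^ a, k - a)\<close> for \<open>a0 \<le> a \<le> k\<close>, where \<open>a0\<close> is
  the maximum of \<open>0\<close> and \<open>k + 1 - w\<close>. The choice \<open>c = r\<close>
  makes \<open>w\<close> positive, since \<open>r ^ n\<close> is congruent to \<open>r\<close>
  modulo \<open>p\<close>. Once \<open>w > k\<close>, its exact value may vary inside the residue
  class, but then \<open>a0 = 0\<close> and the basis does not mention \<open>w\<close>. The
  obstacle is a circle: at a root on a later side the elements of lowest level may have valuation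
  below one and disturb the others, while the lowest level is accessible only when the others are
  under control. It is broken by first treating indices that keep a distance \<open>g\<close> from
  the end of their level, then the lowest level, then the rest. For \<open>p = 2\<close> that
  distance swallows the level next to the lowest, and the two must be treated together. Roots on a
  prescribed side come from extracting \<open>p\<close>-th roots of \<open>m\<close> one at a time,
  always the one closest to the power of \<open>c\<close>, except for one twist by a
  \<open>p\<close>-th root of unity.\<close>

hide_const (open) UnivPoly.coeff UnivPoly.monom Module.smult

section \<open>Valuation rings of a field\<close>

locale unital_subring =
  fixes A :: "'a::field set"
  assumes one_mem [simp, intro]: "1 \<in> A"
    and diff_mem [intro]: "x \<in> A \<Longrightarrow> y \<in> A \<Longrightarrow> x - y \<in> A"
    and mult_mem [intro]: "x \<in> A \<Longrightarrow> y \<in> A \<Longrightarrow> x * y \<in> A"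
begin

lemma zero_mem [simp, intro]: "0 \<in> A"
  using diff_mem[of 1 1] by simp

lemma uminus_mem [intro]: "x \<in> A \<Longrightarrow> - x \<in> A"
  using diff_mem[of 0 x] by simp

lemma add_mem [intro]: "x \<in> A \<Longrightarrow> y \<in> A \<Longrightarrow> x + y \<in> A"
  using diff_mem[of x "- y"] by auto

lemma power_mem [intro]: "x \<in> A \<Longrightarrow> x ^ n \<in> A"
  by (induction n) auto

lemma sum_mem [intro]: "(\<And>i. i \<in> I \<Longrightarrow> f i \<in> A) \<Longrightarrow> sum f I \<in> A"
  by (induction I rule: infinite_finite_induct) auto

lemma of_nat_mem [simp, intro]: "of_nat n \<in> A"
  by (induction n) auto

lemma of_int_mem [simp, intro]: "of_int i \<in> A"
  by (cases i) auto

definition adjoin :: "'a \<Rightarrow> 'a set" where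
  "adjoin x = {poly f x | f. \<forall>i. coeff f i \<in> A}"

lemma adjoin_subring: "unital_subring (adjoin x)"
proof
  show "1 \<in> adjoin x"
    unfolding adjoin_def by (rule CollectI, rule exI[of _ 1]) (auto simp: coeff_1)
next
  fix u v assume "u \<in> adjoin x" "v \<in> adjoin x"
  then obtain f g where f: "u = poly f x" "\<forall>i. coeff f i \<in> A" and g: "v = poly g x" "\<forall>i. coeff g i \<in> A"
    unfolding adjoin_def by auto
  show "u - v \<in> adjoin x"
    unfolding adjoin_def using f g by (intro CollectI exI[of _ "f - g"]) auto
  have "coeff (f * g) i \<in> A" for i
    unfolding coeff_mult using f g by (intro sum_mem mult_mem) auto
  then show "u * v \<in> adjoin x"
    unfolding adjoin_def using f g by (intro CollectI exI[of _ "f * g"]) auto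
qed

lemma adjoin_superset: "A \<subseteq> adjoin x"
proof
  fix a assume "a \<in> A"
  then show "a \<in> adjoin x"
    unfolding adjoin_def by (intro CollectI exI[of _ "[:a:]"]) (auto simp: coeff_pCons split: nat.splits)
qed

lemma mem_adjoin: "x \<in> adjoin x"
  unfolding adjoin_def
  by (intro CollectI exI[of _ "[:0, 1:]"]) (auto simp: coeff_pCons split: nat.splits)

lemma adjoin_sum:
  assumes "u \<in> adjoin x"
  obtains n b where "\<And>i. b i \<in> A" "u = (\<Sum>i\<le>n. b i * x ^ i)"
  using assms unfolding adjoin_def poly_altdef by blast

end

locale valuation_ring = unital_subring B for B :: "'a::field set" +
  assumes total: "x \<noteq> 0 \<Longrightarrow> x \<in> B \<or> inverse x \<in> B"
begin

text \<open>Valuation rings are integrally closed: otherwise the inverse of \<open>x\<close> lies in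
  \<open>B\<close>, and dividing the equation by \<open>x ^ (d - 1)\<close> writes \<open>x\<close>
  as an element of \<open>B\<close>.\<close>

lemma integral_mem:
  assumes "x ^ d = (\<Sum>i<d. b i * x ^ i)" and "\<And>i. i < d \<Longrightarrow> b i \<in> B"
  shows "x \<in> B"
proof (rule ccontr)
  assume notin: "x \<notin> B"
  then have x0: "x \<noteq> 0" by auto
  with total notin have inv: "inverse x \<in> B" by auto
  have d: "d > 0" using assms(1) by (cases d) auto
  have "x = x ^ d * inverse x ^ (d - 1)"
    using x0 d by (cases d) (auto simp: field_simps)
  also have "\<dots> = (\<Sum>i<d. b i * inverse x ^ (d - 1 - i))"
    unfolding assms(1) sum_distrib_right
  proof (rule sum.cong[OF refl])
    fix i assume "i \<in> {..<d}"
    then have "inverse x ^ (d - 1) = inverse x ^ i * inverse x ^ (d - 1 - i)"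
      by (simp flip: power_add)
    then show "b i * x ^ i * inverse x ^ (d - 1) = b i * inverse x ^ (d - 1 - i)"
      using x0 by (simp add: field_simps)
  qed
  also have "\<dots> \<in> B" using assms(2) inv by auto
  finally show False using notin by simp
qed

end

text \<open>If \<open>1 / y\<close> lies in both \<open>B[x]\<close> and \<open>B[1 / x]\<close>, the relation of lower degree can be used to lower the degree of the other one.\<close>

lemma lower_degree:
  fixes B :: "'a::field set"
  assumes "unital_subring B" and y: "y \<in> B"
    and unit: "\<And>b. b \<in> B \<Longrightarrow> inverse (1 - y * b) \<in> B" "\<And>b. b \<in> B \<Longrightarrow> 1 - y * b \<noteq> 0"
    and x: "x \<noteq> 0"
    and b: "\<And>i. i \<le> n \<Longrightarrow> b i \<in> B" "y * (\<Sum>i\<le>n. b i * x ^ i) = 1"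
    and c: "\<And>i. i \<le> m \<Longrightarrow> c i \<in> B" "y * (\<Sum>i\<le>m. c i * inverse x ^ i) = 1"
    and mn: "m \<le> n"
  shows "\<exists>n'<n. \<exists>b'. (\<forall>i\<le>n'. b' i \<in> B) \<and> y * (\<Sum>i\<le>n'. b' i * x ^ i) = 1"
proof -
  interpret unital_subring B by fact
  define c' where "c' i = (if i \<le> m then c i else 0)" for i
  have c'B: "c' i \<in> B" for i using c(1) by (auto simp: c'_def)
  have "(\<Sum>i\<le>m. c i * inverse x ^ i) = (\<Sum>i\<le>n. c' i * inverse x ^ i)"
    using mn by (intro sum.mono_neutral_cong_left) (auto simp: c'_def)
  with c(2) have c': "y * (\<Sum>i\<le>n. c' i * inverse x ^ i) = 1" by simp
  have n: "n > 0"
  proof (rule ccontr)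
    assume "\<not> n > 0"
    with b have "1 - y * b 0 = 0" "b 0 \<in> B" by auto
    with unit(2) show False by blast
  qed
  then obtain n' where n': "n = Suc n'" by (cases n) auto
  \<comment> \<open>As \<open>s\<close> is a unit, the relation for the inverse of \<open>x\<close>
    can be solved for \<open>x ^ n\<close> in terms of lower powers; substituting this into the
    leading term of the other relation gives \<open>b'\<close>.\<close>
  define s where "s = 1 - y * c' 0"
  have s: "s \<noteq> 0" "inverse s \<in> B" unfolding s_def using unit c'B by auto
  define b' where "b' i = b i + b n * (y * c' (n - i) * inverse s)" for i
  have "s = y * (\<Sum>i\<in>{1..n}. c' i * inverse x ^ i)"
  proof -
    have "{..n} = insert 0 {1..n}" by auto
    then have "1 = y * c' 0 + y * (\<Sum>i\<in>{1..n}. c' i * inverse x ^ i)"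
      using c' by (simp add: distrib_left)
    then show ?thesis by (simp add: s_def algebra_simps)
  qed
  then have "x ^ n * s = y * (\<Sum>i\<in>{1..n}. c' i * (x ^ n * inverse x ^ i))"
    by (simp add: sum_distrib_left algebra_simps)
  also have "(\<Sum>i\<in>{1..n}. c' i * (x ^ n * inverse x ^ i)) = (\<Sum>i\<in>{1..n}. c' i * x ^ (n - i))"
  proof (rule sum.cong[OF refl])
    fix i assume "i \<in> {1..n}"
    then have "x ^ n = x ^ (n - i) * x ^ i" by (simp flip: power_add)
    then show "c' i * (x ^ n * inverse x ^ i) = c' i * x ^ (n - i)"
      using x by (simp add: field_simps)
  qed
  also have "\<dots> = (\<Sum>i\<le>n'. c' (n - i) * x ^ i)"
    by (rule sum.reindex_bij_witness[of _ "\<lambda>i. n - i" "\<lambda>i. n - i"]) (auto simp: n')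
  finally have xn: "x ^ n = y * inverse s * (\<Sum>i\<le>n'. c' (n - i) * x ^ i)"
    using s(1) by (simp add: field_simps)
  have "(\<Sum>i\<le>n'. b' i * x ^ i) = (\<Sum>i\<le>n'. b i * x ^ i) + b n * x ^ n"
    unfolding xn b'_def by (simp add: algebra_simps sum.distrib sum_distrib_left)
  also have "\<dots> = (\<Sum>i\<le>n. b i * x ^ i)" by (simp add: n')
  finally have "y * (\<Sum>i\<le>n'. b' i * x ^ i) = 1" using b(2) by simp
  moreover have "\<forall>i\<le>n'. b' i \<in> B"
    unfolding b'_def using b(1) c'B s(2) y n' by (intro allI impI add_mem mult_mem) auto
  ultimately show ?thesis using n' by blast
qed

text \<open>A subring \<open>B\<close> maximal among those omitting the inverse of \<open>y\<close>
  is a valuation ring: if it missed both \<open>x\<close> and its inverse, adjoining either would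
  bring in the inverse of \<open>y\<close>, and \<open>lower_degree\<close> would descend forever on
  the two relations.\<close>

theorem valuation_ring_extension:
  fixes A :: "'a::field set"
  assumes A: "unital_subring A" and y: "y \<in> A" "inverse y \<notin> A"
  obtains B where "valuation_ring B" "A \<subseteq> B" "inverse y \<notin> B"
proof -
  define \<S> where "\<S> = {B. unital_subring B \<and> A \<subseteq> B \<and> inverse y \<notin> B}"
  have "\<S> \<noteq> {}" using A y by (auto simp: \<S>_def)
  moreover have "\<Union>\<C> \<in> \<S>" if C: "\<C> \<noteq> {}" "subset.chain \<S> \<C>" for \<C>
  proof -
    have sub: "\<And>X. X \<in> \<C> \<Longrightarrow> X \<in> \<S>" and lin: "\<And>X Y. X \<in> \<C> \<Longrightarrow> Y \<in> \<C> \<Longrightarrow> X \<subseteq> Y \<or> Y \<subseteq> X"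
      using C by (auto simp: subset.chain_def)
    have ring: "unital_subring X" if "X \<in> \<C>" for X
      using sub[OF that] by (auto simp: \<S>_def)
    have "unital_subring (\<Union>\<C>)"
    proof
      show "1 \<in> \<Union>\<C>" using C(1) ring unital_subring.one_mem by blast
    next
      fix u v assume "u \<in> \<Union>\<C>" "v \<in> \<Union>\<C>"
      then obtain X where X: "X \<in> \<C>" "u \<in> X" "v \<in> X" using lin by blast
      show "u - v \<in> \<Union>\<C>" "u * v \<in> \<Union>\<C>"
        using X ring[OF X(1)] unital_subring.diff_mem unital_subring.mult_mem by blast+
    qed
    then show ?thesis using C sub by (auto simp: \<S>_def)
  qed
  ultimately obtain B where BS: "B \<in> \<S>" and max: "\<And>X. X \<in> \<S> \<Longrightarrow> B \<subseteq> X \<Longrightarrow> X = B"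
    using subset_Zorn_nonempty[of \<S>] by blast
  interpret unital_subring B using BS by (simp add: \<S>_def)
  have AB: "A \<subseteq> B" and yB: "inverse y \<notin> B" using BS by (auto simp: \<S>_def)
  have y': "y \<in> B" "y \<noteq> 0" using y AB yB by auto
  have adj: "inverse y \<in> adjoin x" if "x \<notin> B" for x
  proof (rule ccontr)
    assume "inverse y \<notin> adjoin x"
    with adjoin_subring[of x] adjoin_superset[of x] AB have "adjoin x \<in> \<S>"
      by (auto simp: \<S>_def)
    from max[OF this adjoin_superset] that mem_adjoin[of x] show False by simp
  qed
  have nz: "1 - y * b \<noteq> 0" if "b \<in> B" for b
  proof
    assume "1 - y * b = 0"
    then have "b = inverse y" using y' by (simp add: field_simps)
    with that yB show False by simp
  qed
  \<comment> \<open>\<open>y\<close> lies in the Jacobson radical of \<open>B\<close>. Otherwise,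
    with \<open>s = 1 - y * b\<close>, the inverse of \<open>y\<close> lies in
    \<open>B[1 / s]\<close>, so \<open>s ^ d / y\<close> is in \<open>B\<close>; since
    \<open>s ^ d\<close> is \<open>1\<close> modulo \<open>y\<close>, so would be
    \<open>1 / y\<close>.\<close>
  have unit: "inverse (1 - y * b) \<in> B" if b: "b \<in> B" for b
  proof (rule ccontr)
    define s where "s = 1 - y * b"
    assume "inverse (1 - y * b) \<notin> B"
    then have "inverse y \<in> adjoin (inverse s)" by (auto intro: adj simp: s_def)
    then obtain d c where c: "\<And>i. c i \<in> B" "inverse y = (\<Sum>i\<le>d. c i * inverse s ^ i)"
      using adjoin_sum by metis
    have sB: "s \<in> B" "s \<noteq> 0" unfolding s_def using b y' nz by auto
    have "inverse y * s ^ d = (\<Sum>i\<le>d. c i * s ^ (d - i))"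
      unfolding c(2) sum_distrib_right
    proof (rule sum.cong[OF refl])
      fix i assume "i \<in> {..d}"
      then have "s ^ d = s ^ i * s ^ (d - i)" by (simp flip: power_add)
      then show "c i * inverse s ^ i * s ^ d = c i * s ^ (d - i)"
        using sB by (simp add: field_simps)
    qed
    also have "\<dots> \<in> B" using c sB by auto
    finally have 1: "inverse y * s ^ d \<in> B" .
    have "\<exists>e\<in>B. s ^ d = 1 - y * e"
    proof (induction d)
      case (Suc d)
      then obtain e where e: "e \<in> B" "s ^ d = 1 - y * e" by blast
      have "s ^ Suc d = 1 - y * (e + b - y * b * e)"
        by (simp add: e(2)) (simp add: s_def algebra_simps)
      moreover have "e + b - y * b * e \<in> B" using e b y' by auto
      ultimately show ?case by blast
    qed auto
    then obtain e where e: "e \<in> B" "s ^ d = 1 - y * e" by blast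
    then have "inverse y * s ^ d + e = inverse y" using y' by (simp add: field_simps)
    with add_mem[OF 1 e(1)] yB show False by metis
  qed
  define P where "P x n \<longleftrightarrow> (\<exists>b. (\<forall>i\<le>n. b i \<in> B) \<and> y * (\<Sum>i\<le>n. b i * x ^ i) = 1)" for x n
  have exP: "\<exists>n. P x n" if x: "x \<notin> B" for x
  proof -
    obtain d c where c: "\<And>i. c i \<in> B" "inverse y = (\<Sum>i\<le>d. c i * x ^ i)"
      using adjoin_sum[OF adj[OF x]] by metis
    then have "y * (\<Sum>i\<le>d. c i * x ^ i) = 1" using y' by (metis right_inverse)
    with c(1) show ?thesis unfolding P_def by blast
  qed
  have lower: "\<exists>n'<n. P x n'" if P: "P x n" "P (inverse x) m" and mn: "m \<le> n" "x \<noteq> 0" for x n m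
  proof -
    obtain b where b: "\<And>i. i \<le> n \<Longrightarrow> b i \<in> B" "y * (\<Sum>i\<le>n. b i * x ^ i) = 1"
      using P(1) unfolding P_def by auto
    obtain c where c: "\<And>i. i \<le> m \<Longrightarrow> c i \<in> B" "y * (\<Sum>i\<le>m. c i * inverse x ^ i) = 1"
      using P(2) unfolding P_def by auto
    show ?thesis unfolding P_def
      by (rule lower_degree[OF unital_subring_axioms y'(1) unit nz mn(2) b c mn(1)]) auto
  qed
  have "x \<in> B \<or> inverse x \<in> B" if x: "x \<noteq> 0" for x
  proof (rule ccontr)
    assume "\<not> (x \<in> B \<or> inverse x \<in> B)"
    then have ex: "\<exists>n. P x n" "\<exists>n. P (inverse x) n" using exP by auto
    define n where "n = (LEAST n. P x n)"
    define m where "m = (LEAST n. P (inverse x) n)"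
    have n: "P x n" "\<And>i. i < n \<Longrightarrow> \<not> P x i" unfolding n_def
      using LeastI_ex[OF ex(1)] not_less_Least by auto
    have m: "P (inverse x) m" "\<And>i. i < m \<Longrightarrow> \<not> P (inverse x) i" unfolding m_def
      using LeastI_ex[OF ex(2)] not_less_Least by auto
    \<comment> \<open>Whichever of \<open>x\<close> and its inverse has the larger minimal degree
      contradicts that minimality.\<close>
    show False
      using lower[of x n m] lower[of "inverse x" m n] n m x by (cases "m \<le> n") auto
  qed
  then have "valuation_ring B" by unfold_locales
  with AB yB that show thesis by blast
qed

section \<open>Algebraic integers as the intersection of all valuation rings\<close>

lemma unital_subring_Ints: "unital_subring (\<int> :: 'a::field set)"
  by unfold_locales auto

text \<open>Multiplying an expression of \<open>x\<close> in powers of its inverse by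
  \<open>x ^ d\<close> gives a monic equation.\<close>

lemma integral_if_mem_adjoin_inverse:
  assumes "unital_subring A" and "x \<in> unital_subring.adjoin A (inverse x)"
  shows "\<exists>d b. x ^ d = (\<Sum>i<d. b i * x ^ i) \<and> (\<forall>i. b i \<in> A)"
proof -
  interpret unital_subring A by fact
  obtain d c where c: "\<And>i. c i \<in> A" "x = (\<Sum>i\<le>d. c i * inverse x ^ i)"
    using adjoin_sum[OF assms(2)] by metis
  show ?thesis
  proof (cases "x = 0")
    case True
    then show ?thesis by (intro exI[of _ 1] exI[of _ "\<lambda>_. 0"]) auto
  next
    case False
    have "x ^ Suc d = (\<Sum>i\<le>d. c i * inverse x ^ i) * x ^ d"
      using c(2) by simp
    also have "\<dots> = (\<Sum>i\<le>d. c i * x ^ (d - i))"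
      unfolding sum_distrib_right
    proof (rule sum.cong[OF refl])
      fix i assume "i \<in> {..d}"
      then have "x ^ d = x ^ i * x ^ (d - i)" by (simp flip: power_add)
      then show "c i * inverse x ^ i * x ^ d = c i * x ^ (d - i)"
        using False by (simp add: field_simps)
    qed
    also have "\<dots> = (\<Sum>i<Suc d. c (d - i) * x ^ i)"
      by (rule sum.reindex_bij_witness[of _ "\<lambda>i. d - i" "\<lambda>i. d - i"]) auto
    finally show ?thesis using c(1) by (intro exI[of _ "Suc d"] exI[of _ "\<lambda>i. c (d - i)"]) auto
  qed
qed

text \<open>If \<open>x\<close> is not integral, it is outside the ring generated by its inverse,
  and the extension theorem with \<open>y = inverse x\<close> gives a valuation ring omitting
  \<open>x\<close>. Closure of the algebraic integers under ring operations and under integral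
  equations follows from this.\<close>

theorem algebraic_int_iff_valuation_rings:
  fixes x :: "'a::field_char_0"
  shows "algebraic_int x \<longleftrightarrow> (\<forall>B :: 'a set. valuation_ring B \<longrightarrow> x \<in> B)"
proof safe
  fix B :: "'a set" assume x: "algebraic_int x" and "valuation_ring B"
  interpret valuation_ring B by fact
  from x obtain p where p: "lead_coeff p = 1" "\<forall>i. coeff p i \<in> \<int>" "poly p x = 0"
    by (auto elim: algebraic_int.cases)
  show "x \<in> B"
  proof (rule integral_mem[where b = "\<lambda>i. - coeff p i"])
    have "0 = (\<Sum>i<Suc (degree p). coeff p i * x ^ i)"
      using p(3) by (simp add: poly_altdef lessThan_Suc_atMost)
    also have "\<dots> = (\<Sum>i<degree p. coeff p i * x ^ i) + x ^ degree p"
      using p(1) by simp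
    finally show "x ^ degree p = (\<Sum>i<degree p. - coeff p i * x ^ i)"
      by (simp add: sum_negf add_eq_0_iff2)
    show "- coeff p i \<in> B" for i
    proof -
      have "coeff p i \<in> \<int>" using p(2) by simp
      then obtain z where "coeff p i = of_int z" by (rule Ints_cases)
      then show ?thesis using uminus_mem[OF of_int_mem[of z]] by simp
    qed
  qed
next
  assume B: "\<forall>B :: 'a set. valuation_ring B \<longrightarrow> x \<in> B"
  interpret Z: unital_subring "\<int> :: 'a set" by (rule unital_subring_Ints)
  have "x \<in> Z.adjoin (inverse x)"
  proof (rule ccontr)
    assume "x \<notin> Z.adjoin (inverse x)"
    then have "inverse (inverse x) \<notin> Z.adjoin (inverse x)" by simp
    then obtain B where "valuation_ring B" "inverse (inverse x) \<notin> B"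
      using valuation_ring_extension[OF Z.adjoin_subring Z.mem_adjoin] by metis
    with B show False by simp
  qed
  then obtain d b where b: "x ^ d = (\<Sum>i<d. b i * x ^ i)" "\<And>i. b i \<in> \<int>"
    using integral_if_mem_adjoin_inverse[OF unital_subring_Ints] by metis
  define p where "p = monom 1 d - (\<Sum>i<d. monom (b i) i)"
  have co: "coeff p i = (if i = d then 1 else if i < d then - b i else 0)" for i
    by (simp add: p_def coeff_sum)
  have deg: "degree p = d"
  proof (rule antisym)
    show "degree p \<le> d" by (rule degree_le) (simp add: co)
    show "d \<le> degree p" by (rule le_degree) (simp add: co)
  qed
  show "algebraic_int x"
  proof (rule algebraic_int.intros[of p])
    show "lead_coeff p = 1" using co deg by simp
    show "\<forall>i. coeff p i \<in> \<int>" using co b by auto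
    show "poly p x = 0" using b by (simp add: p_def poly_monom poly_sum)
  qed
qed

lemma unital_subring_algebraic_int: "unital_subring {x :: 'a::field_char_0. algebraic_int x}"
proof
  fix x y :: 'a assume xy: "x \<in> {x. algebraic_int x}" "y \<in> {x. algebraic_int x}"
  have "x - y \<in> B \<and> x * y \<in> B" if "valuation_ring B" for B :: "'a set"
  proof -
    interpret valuation_ring B by fact
    have "x \<in> B" "y \<in> B" using xy that by (auto simp: algebraic_int_iff_valuation_rings)
    then show ?thesis by blast
  qed
  then show "x - y \<in> {x. algebraic_int x}" "x * y \<in> {x. algebraic_int x}"
    by (simp_all add: algebraic_int_iff_valuation_rings)
qed simp

text \<open>An intersection of integrally closed rings is integrally closed; needed for the
  quadratic equation in \<open>cofactor_integral\<close>.\<close>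

lemma algebraic_int_integral_closure:
  fixes x :: "'a::field_char_0"
  assumes "x ^ d = (\<Sum>i<d. b i * x ^ i)" and "\<And>i. i < d \<Longrightarrow> algebraic_int (b i)"
  shows "algebraic_int x"
  unfolding algebraic_int_iff_valuation_rings
proof (intro allI impI)
  fix B :: "'a set" assume B: "valuation_ring B"
  have "b i \<in> B" if "i < d" for i
    using assms(2)[OF that] B by (simp add: algebraic_int_iff_valuation_rings)
  then show "x \<in> B" by (rule valuation_ring.integral_mem[OF B assms(1)])
qed

section \<open>Valuations of residue characteristic q\<close>

text \<open>The inner binomial coefficients are divisible by \<open>q\<close>. The shape isolates
  the two terms that compete for the smallest valuation when \<open>c\<close> is a unit:
  \<open>(y - c) ^ q\<close> and \<open>q * (y - c) * c ^ (q - 1)\<close>.\<close>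

lemma (in unital_subring) prime_power_diff:
  assumes q: "prime q" and d: "y - c \<in> A" and c: "c \<in> A"
  obtains h where "h \<in> A"
    "y ^ q - c ^ q = (y - c) ^ q + of_nat q * (y - c) * (c ^ (q - 1) + (y - c) * h)"
proof -
  define e where "e = y - c"
  have y: "y = e + c" by (simp add: e_def)
  define h where "h = (\<Sum>i\<in>{2..<q}. of_nat ((q choose i) div q) * e ^ (i - 2) * c ^ (q - i))"
  have q2: "q \<ge> 2" using q prime_ge_2_nat by blast
  have "{..q} = insert q (insert 0 (insert 1 {2..<q}))" using q2 by auto
  then have "y ^ q = e ^ q + c ^ q + of_nat q * e * c ^ (q - 1)
      + (\<Sum>i\<in>{2..<q}. of_nat (q choose i) * e ^ i * c ^ (q - i))"
    unfolding y binomial_ring using q2 by simp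
  also have "(\<Sum>i\<in>{2..<q}. of_nat (q choose i) * e ^ i * c ^ (q - i)) = of_nat q * e * (e * h)"
    unfolding h_def sum_distrib_left
  proof (rule sum.cong[OF refl])
    fix i assume i: "i \<in> {2..<q}"
    then have "q dvd (q choose i)" using q by (intro dvd_choose_prime) auto
    then have "(of_nat (q choose i) :: 'a) = of_nat q * of_nat ((q choose i) div q)"
      by (metis dvd_mult_div_cancel of_nat_mult)
    moreover have "e ^ i = e * e * e ^ (i - 2)"
      using i by (metis atLeastLessThan_iff le_add_diff_inverse power2_eq_square power_add)
    ultimately show "of_nat (q choose i) * e ^ i * c ^ (q - i) =
        of_nat q * e * (e * (of_nat ((q choose i) div q) * e ^ (i - 2) * c ^ (q - i)))"
      by (simp add: mult_ac)
  qed
  finally have "y ^ q - c ^ q = e ^ q + of_nat q * e * (c ^ (q - 1) + e * h)"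
    by (simp add: algebra_simps)
  moreover have "h \<in> A"
    unfolding h_def e_def using d c by (intro sum_mem mult_mem power_mem of_nat_mem)
  ultimately show thesis using that unfolding e_def by blast
qed

lemma (in valuation_ring) root_mem:
  assumes "x ^ n \<in> B" "n > 0"
  shows "x \<in> B"
proof (rule integral_mem)
  show "x ^ n = (\<Sum>i<n. (if i = 0 then x ^ n else 0) * x ^ i)"
    using assms(2) by (simp add: if_distrib[where f = "\<lambda>a. a * _"] cong: if_cong)
qed (use assms in auto)

text \<open>Locality of \<open>B\<close>, phrased with \<open>inverse t\<close> because units and
  nonunits are told apart only by membership of inverses.\<close>

lemma (in valuation_ring) unit_add_nonunit:
  assumes "u \<in> B" "inverse u \<in> B" "u \<noteq> 0" and "t \<in> B" "t = 0 \<or> inverse t \<notin> B"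
  shows "u + t \<noteq> 0" "inverse (u + t) \<in> B"
proof -
  show 0: "u + t \<noteq> 0"
  proof
    assume "u + t = 0"
    then have "t = - u" by (simp add: add_eq_0_iff)
    with assms show False using uminus_mem[of "inverse u"] by auto
  qed
  show "inverse (u + t) \<in> B"
  proof (cases "t = 0")
    case True
    then show ?thesis using assms by simp
  next
    case False
    define s where "s = u + t"
    have s: "s \<noteq> 0" using 0 by (simp add: s_def)
    have "s / t \<in> B \<or> t / s \<in> B" using total[of "s / t"] s False by (auto simp: field_simps)
    then have "t / s \<in> B"
    proof
      assume "s / t \<in> B"
      then have "inverse u * (s / t - 1) \<in> B" using assms by (intro mult_mem diff_mem) auto
      moreover have "inverse u * (s / t - 1) = inverse t"
        using assms(3) False by (simp add: s_def field_simps)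
      ultimately show ?thesis using assms False by simp
    qed
    then have "inverse u * (1 - t / s) \<in> B" using assms by (intro mult_mem diff_mem) auto
    moreover have "inverse u * (1 - t / s) = inverse s"
      using assms(3) s by (simp add: s_def field_simps)
    ultimately show ?thesis by (simp add: s_def)
  qed
qed

text \<open>A root \<open>\<pi>\<close> of the residue characteristic measures valuations: \<open>val_ge a x\<close> and
  \<open>val_eq a x\<close> say \<open>v(x) \<ge> a / N\<close> and \<open>v(x) = a / N\<close> for the valuation with \<open>v(q) = 1\<close>.\<close>

locale prime_valuation = valuation_ring B for B :: "complex set" +
  fixes q N :: nat and \<pi> :: complex
  assumes prime_q: "prime q" and not_unit_q: "inverse (of_nat q) \<notin> B"
    and N_pos: "N > 0" and pi_power: "\<pi> ^ N = of_nat q"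
begin

definition val_ge :: "int \<Rightarrow> complex \<Rightarrow> bool" where
  "val_ge a x \<longleftrightarrow> x / \<pi> powi a \<in> B"

definition val_eq :: "int \<Rightarrow> complex \<Rightarrow> bool" where
  "val_eq a x \<longleftrightarrow> x \<noteq> 0 \<and> val_ge a x \<and> \<pi> powi a / x \<in> B"

lemma q_nonzero: "(of_nat q :: complex) \<noteq> 0"
  using prime_q by (auto simp: prime_gt_0_nat)

lemma pi_nonzero [simp]: "\<pi> \<noteq> 0"
  using pi_power q_nonzero N_pos by (metis zero_power)

lemma pi_mem: "\<pi> \<in> B"
  using root_mem[of \<pi> N] pi_power N_pos by auto

lemma inverse_pi_notin: "inverse \<pi> \<notin> B"
proof
  assume "inverse \<pi> \<in> B"
  then have "inverse \<pi> ^ N \<in> B" by auto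
  then show False using not_unit_q pi_power by (simp add: power_inverse)
qed

lemma powi_mem: "a \<ge> 0 \<Longrightarrow> \<pi> powi a \<in> B"
  using pi_mem by (auto simp: power_int_def)

lemma val_ge_0_iff: "val_ge 0 x \<longleftrightarrow> x \<in> B"
  by (simp add: val_ge_def)

lemma val_ge_zero [simp]: "val_ge a 0"
  by (simp add: val_ge_def)

lemma val_ge_mult: "val_ge a x \<Longrightarrow> val_ge b y \<Longrightarrow> val_ge (a + b) (x * y)"
  using mult_mem[of "x / \<pi> powi a" "y / \<pi> powi b"] by (simp add: val_ge_def power_int_add)

lemma val_ge_mono: "val_ge a x \<Longrightarrow> b \<le> a \<Longrightarrow> val_ge b x"
  using mult_mem[of "x / \<pi> powi a" "\<pi> powi (a - b)"] powi_mem[of "a - b"]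
  by (simp add: val_ge_def power_int_diff)

lemma val_ge_add: "val_ge a x \<Longrightarrow> val_ge a y \<Longrightarrow> val_ge a (x + y)"
  using add_mem[of "x / \<pi> powi a" "y / \<pi> powi a"] by (simp add: val_ge_def add_divide_distrib)

lemma val_ge_uminus: "val_ge a x \<Longrightarrow> val_ge a (- x)"
  using uminus_mem[of "x / \<pi> powi a"] by (simp add: val_ge_def)

lemma val_ge_sum: "(\<And>i. i \<in> I \<Longrightarrow> val_ge a (f i)) \<Longrightarrow> val_ge a (sum f I)"
  by (induction I rule: infinite_finite_induct) (auto intro: val_ge_add)

text \<open>A complex number need not have a value in the multiples of \<open>1 / N\<close>, so
  roots are handled by integral closedness of \<open>B\<close> and not by halving values.\<close>

lemma val_ge_root:
  assumes "val_ge (int n * a) (x ^ n)" "n > 0"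
  shows "val_ge a x"
proof -
  have "(x / \<pi> powi a) ^ n = x ^ n / \<pi> powi (int n * a)"
    by (simp add: power_divide mult.commute flip: power_int_power')
  then show ?thesis
    using assms root_mem[of "x / \<pi> powi a" n] unfolding val_ge_def by (metis)
qed

lemma val_eq_ge: "val_eq a x \<Longrightarrow> val_ge a x"
  by (simp add: val_eq_def)

lemma val_eq_nonzero: "val_eq a x \<Longrightarrow> x \<noteq> 0"
  by (simp add: val_eq_def)

lemma val_eq_altdef: "val_eq a x \<longleftrightarrow> x \<noteq> 0 \<and> val_ge a x \<and> val_ge (- a) (inverse x)"
  by (auto simp: val_eq_def val_ge_def power_int_minus field_simps)

lemma val_eq_mult: "val_eq a x \<Longrightarrow> val_eq b y \<Longrightarrow> val_eq (a + b) (x * y)"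
  using val_ge_mult[of "-a" "inverse x" "-b" "inverse y"]
  by (simp add: val_eq_altdef val_ge_mult)

lemma val_eq_inverse: "val_eq a x \<Longrightarrow> val_eq (- a) (inverse x)"
  by (simp add: val_eq_altdef)

lemma val_eq_divide: "val_eq a x \<Longrightarrow> val_eq b y \<Longrightarrow> val_eq (a - b) (x / y)"
  using val_eq_mult[OF _ val_eq_inverse, of a x b y] by (simp add: divide_inverse)

lemma val_eq_uminus: "val_eq a x \<Longrightarrow> val_eq a (- x)"
  by (simp add: val_eq_altdef val_ge_uminus)

lemma val_eq_one: "val_eq 0 1"
  by (simp add: val_eq_def val_ge_def)

lemma val_eq_power: "val_eq a x \<Longrightarrow> val_eq (int n * a) (x ^ n)"
  by (induction n) (auto simp: distrib_right val_eq_one intro: val_eq_mult)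

lemma val_eq_root:
  assumes "val_eq (int n * a) (x ^ n)" "n > 0"
  shows "val_eq a x"
  using assms val_ge_root[of n a x] val_ge_root[of n "-a" "inverse x"]
  by (auto simp: val_eq_altdef power_inverse)

lemma val_eq_imp_le:
  assumes "val_eq a x" "val_ge b x"
  shows "b \<le> a"
proof (rule ccontr)
  assume "\<not> b \<le> a"
  then have "val_ge (a + 1) x" using assms(2) val_ge_mono by auto
  then have "val_ge (a + 1 + (- a)) (x * inverse x)"
    using assms(1) by (intro val_ge_mult) (auto simp: val_eq_altdef)
  then show False
    using inverse_pi_notin val_eq_nonzero[OF assms(1)] by (simp add: val_ge_def inverse_eq_divide)
qed

lemma val_eq_unique: "val_eq a x \<Longrightarrow> val_eq b x \<Longrightarrow> a = b"
  using val_eq_imp_le val_eq_ge by (meson antisym)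

lemma val_eq_0_iff: "val_eq 0 x \<longleftrightarrow> x \<noteq> 0 \<and> x \<in> B \<and> inverse x \<in> B"
  by (simp add: val_eq_altdef val_ge_0_iff)

lemma val_eq_pi: "val_eq a (\<pi> powi a)"
  by (simp add: val_eq_def val_ge_def)

lemma val_eq_add:
  assumes "val_eq a x" "val_ge b y" "a < b"
  shows "val_eq a (x + y)"
proof -
  define u t where "u = x / \<pi> powi a" and "t = y / \<pi> powi a"
  have u: "val_eq 0 u" using val_eq_divide[OF assms(1) val_eq_pi[of a]] by (simp add: u_def)
  \<comment> \<open>Exponents are integers, so a strict inequality leaves a whole factor
    \<open>\<pi>\<close> to spare, which makes \<open>t\<close> a nonunit.\<close>
  have "val_ge a y" "val_ge (a + 1) y" using assms(2,3) val_ge_mono by auto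
  then have t: "t \<in> B" "t / \<pi> \<in> B"
    by (auto simp: val_ge_def t_def power_int_add mult_ac)
  have "inverse t \<notin> B" if "t \<noteq> 0"
  proof
    assume "inverse t \<in> B"
    then have "t / \<pi> * inverse t \<in> B" using t by blast
    then show False using inverse_pi_notin that by (simp add: inverse_eq_divide)
  qed
  with u t unit_add_nonunit[of u t] have "val_eq 0 (u + t)" by (auto simp: val_eq_0_iff)
  from val_eq_mult[OF this val_eq_pi[of a]] show ?thesis
    by (simp add: u_def t_def distrib_right)
qed

lemma val_eq_sum:
  assumes "finite I" "i \<in> I" "val_eq a (f i)" "\<And>j. j \<in> I \<Longrightarrow> j \<noteq> i \<Longrightarrow> val_ge (a + 1) (f j)"
  shows "val_eq a (sum f I)"
proof -
  have "sum f I = f i + sum f (I - {i})" using assms by (simp add: sum.remove)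
  moreover have "val_ge (a + 1) (sum f (I - {i}))" using assms by (intro val_ge_sum) auto
  ultimately show ?thesis using val_eq_add[OF assms(3)] by auto
qed

lemma val_eq_prime: "val_eq (int N) (of_nat q)"
  using val_eq_pi[of "int N"] pi_power by simp

lemma val_ge_of_int: "val_ge 0 (of_int z)"
  by (simp add: val_ge_0_iff)

lemma val_ge_dvd:
  assumes "int q dvd z"
  shows "val_ge (int N) (of_int z)"
proof -
  obtain y where z: "z = int q * y" using assms by auto
  show ?thesis using val_ge_mult[OF val_eq_ge[OF val_eq_prime] val_ge_of_int[of y]] by (simp add: z)
qed

lemma val_eq_not_dvd:
  assumes "\<not> int q dvd z"
  shows "val_eq 0 (of_int z)"
proof -
  have "coprime (int q) z" using assms prime_q by (simp add: prime_imp_coprime)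
  then obtain u v where uv: "u * int q + v * z = 1" using bezout_int[of "int q" z] by auto
  have "val_eq 0 (of_int (1 - u * int q))"
    using val_eq_add[OF val_eq_one val_ge_dvd[of "- u * int q"]] N_pos by simp
  also have "1 - u * int q = v * z" using uv by simp
  finally have vz: "val_eq 0 (of_int v * of_int z)" by simp
  then have "of_int v * inverse (of_int v * of_int z :: complex) \<in> B"
    by (intro mult_mem) (auto simp: val_eq_0_iff)
  then have "inverse (of_int z) \<in> B"
    using val_eq_nonzero[OF vz] by (simp add: field_simps)
  then show ?thesis using val_eq_nonzero[OF vz] by (auto simp: val_eq_0_iff)
qed

lemma val_eq_prime_power: "\<not> int q dvd z \<Longrightarrow> val_eq (int N * int w) (of_int (int q ^ w * z))"
  using val_eq_mult[OF val_eq_power[OF val_eq_prime, of w] val_eq_not_dvd, of z]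
  by (simp add: mult.commute)

lemma val_ge_iff_dvd_pi: "x \<noteq> 0 \<Longrightarrow> \<not> val_ge a x \<Longrightarrow> \<pi> powi a / x \<in> B"
  using total[of "x / \<pi> powi a"] by (auto simp: val_ge_def field_simps)

end

section \<open>Extraction of q-th roots near a unit\<close>

lemma cis_power_eq_1_imp_dvd:
  assumes "n > 0" "cis (2 * pi / real n) ^ j = 1"
  shows "n dvd j"
proof -
  have "Re (cis (real j * (2 * pi / real n))) = 1" using assms(2) by (simp add: DeMoivre)
  then have "cos (real j * (2 * pi / real n)) = 1" by simp
  then obtain i :: int where "real j * (2 * pi / real n) = of_int i * 2 * pi" using cos_one_2pi_int by auto
  then have "real j = of_int i * real n" using assms(1) by (simp add: field_simps)
  then have "int j = i * int n" by (metis of_int_eq_iff of_int_mult of_int_of_nat_eq)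
  then have "int n dvd int j" by simp
  then show ?thesis by simp
qed

context prime_valuation
begin

lemma q_pos: "q > 0" and q_ge_2: "q \<ge> 2"
  using prime_q by (auto simp: prime_gt_0_nat prime_ge_2_nat)

lemma prime_power_diff_val:
  assumes c: "val_eq 0 c" and v: "val_ge v (y ^ q - c ^ q)" "v \<ge> 0"
  obtains h where "y \<in> B" "h \<in> B"
    "y ^ q - c ^ q = (y - c) ^ q + of_nat q * (y - c) * (c ^ (q - 1) + (y - c) * h)"
proof -
  have cB: "c \<in> B" using c by (simp add: val_eq_0_iff)
  have "y ^ q - c ^ q \<in> B" using v val_ge_mono[of v _ 0] by (simp add: val_ge_0_iff)
  then have "(y ^ q - c ^ q) + c ^ q \<in> B" using cB by (intro add_mem power_mem)
  then have "y \<in> B" using root_mem[of y q] q_pos by simp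
  with prime_power_diff[OF prime_q _ cB, of y] cB that show thesis by blast
qed

text \<open>A bootstrap: knowing only \<open>y - c\<close> in \<open>B\<close>, the mixed term has
  value at least one, which yields the lower bound \<open>v\<close> for \<open>y - c\<close>; with
  that bound the mixed term is strictly smaller in size than \<open>y ^ q - c ^ q\<close>, so
  \<open>(y - c) ^ q\<close> has the same value as the latter.\<close>

lemma prime_root_val_small:
  assumes c: "val_eq 0 c" and D: "val_eq (int q * v) (y ^ q - c ^ q)" and v: "v > 0" "int q * v \<le> int N"
  shows "val_eq v (y - c)"
proof -
  obtain h where h: "y \<in> B" "h \<in> B"
    and eq: "y ^ q - c ^ q = (y - c) ^ q + of_nat q * (y - c) * (c ^ (q - 1) + (y - c) * h)"
    using prime_power_diff_val[OF c val_eq_ge[OF D]] v q_pos by (auto simp: zero_le_mult_iff)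
  have cB: "c \<in> B" using c by (simp add: val_eq_0_iff)
  have g: "val_ge 0 (c ^ (q - 1) + (y - c) * h)"
    using h cB by (auto simp: val_ge_0_iff)
  define r where "r = of_nat q * (y - c) * (c ^ (q - 1) + (y - c) * h)"
  have yc: "val_ge 0 (y - c)" using h cB by (auto simp: val_ge_0_iff)
  have "val_ge (int N + a + 0) r" if "val_ge a (y - c)" for a
    unfolding r_def by (intro val_ge_mult that g val_eq_ge val_eq_prime)
  note r = this
  have pow: "(y - c) ^ q = (y ^ q - c ^ q) - r" using eq by (simp add: r_def)
  have "val_ge (int q * v) (- r)"
    using r[OF yc] v by (auto intro: val_ge_mono val_ge_uminus)
  then have "val_ge (int q * v) ((y - c) ^ q)"
    unfolding pow using val_ge_add[OF val_eq_ge[OF D], of "- r"] by simp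
  then have "val_ge v (y - c)" by (rule val_ge_root) (rule q_pos)
  from r[OF this] have "val_ge (int N + v) (- r)" by (simp add: val_ge_uminus)
  then have "val_eq (int q * v) ((y - c) ^ q)"
    unfolding pow using val_eq_add[OF D, of _ "- r"] v by simp
  then show ?thesis by (rule val_eq_root) (rule q_pos)
qed

lemma uniformizer_exponent_pos:
  assumes "int N = int (q - 1) * \<mu>"
  shows "\<mu> > 0"
proof -
  have "int (q - 1) * \<mu> > 0" "int (q - 1) > 0" using assms N_pos q_ge_2 by auto
  then show ?thesis by (rule zero_less_mult_pos)
qed

text \<open>Cancelling \<open>z - 1\<close> in the expansion of \<open>z ^ q - 1\<close> leaves
  \<open>(z - 1) ^ (q - 1)\<close> equal to \<open>q\<close> times a unit. Thus \<open>\<mu>\<close>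
  stands for the value \<open>1 / (q - 1)\<close>.\<close>

lemma root_of_unity_val:
  assumes \<mu>: "int N = int (q - 1) * \<mu>" and z: "z ^ q = 1" "z \<noteq> 1"
  shows "val_eq \<mu> (z - 1)"
proof -
  obtain h where h: "z \<in> B" "h \<in> B"
    and eq: "z ^ q - 1 ^ q = (z - 1) ^ q + of_nat q * (z - 1) * (1 ^ (q - 1) + (z - 1) * h)"
    using prime_power_diff_val[OF val_eq_one, of 0 z] z by auto
  have q1: "q - 1 > 0" using q_ge_2 by simp
  have \<mu>0: "\<mu> > 0" using \<mu> by (rule uniformizer_exponent_pos)
  have "(z - 1) * ((z - 1) ^ (q - 1) + of_nat q * (1 + (z - 1) * h)) = 0"
    using eq z(1) q_pos by (simp add: algebra_simps flip: power_Suc)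
  then have eq': "(z - 1) ^ (q - 1) = - (of_nat q * (1 + (z - 1) * h))"
    using z(2) by (simp add: eq_neg_iff_add_eq_0)
  have "val_ge 0 (1 + (z - 1) * h)" using h by (auto simp: val_ge_0_iff)
  from val_ge_mult[OF val_eq_ge[OF val_eq_prime] this]
  have "val_ge (int (q - 1) * \<mu>) ((z - 1) ^ (q - 1))"
    unfolding eq' using \<mu> by (simp add: val_ge_uminus)
  then have "val_ge \<mu> (z - 1)" by (rule val_ge_root) (rule q1)
  then have "val_ge (\<mu> + 0) ((z - 1) * h)" using h by (intro val_ge_mult) (auto simp: val_ge_0_iff)
  then have "val_eq 0 (1 + (z - 1) * h)" using \<mu>0 by (intro val_eq_add[OF val_eq_one]) auto
  from val_eq_uminus[OF val_eq_mult[OF val_eq_prime this]]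
  have "val_eq (int (q - 1) * \<mu>) ((z - 1) ^ (q - 1))" unfolding eq' using \<mu> by simp
  then show ?thesis by (rule val_eq_root) (rule q1)
qed

text \<open>Failure of the bound only says that \<open>\<pi> powi \<mu> / (y - c)\<close> is a
  nonunit \<open>\<delta>\<close> of \<open>B\<close>. As \<open>q\<close> is the
  \<open>(q - 1)\<close>-st power of \<open>\<pi> powi \<mu>\<close>, dividing the expansion by
  \<open>(y - c) ^ q\<close> exhibits \<open>1\<close> as a multiple of
  \<open>\<delta>\<close>.\<close>

lemma prime_root_val_ge:
  assumes c: "val_eq 0 c" and D: "val_ge (int N * v) (y ^ q - c ^ q)" and v: "v \<ge> 2"
    and \<mu>: "int N = int (q - 1) * \<mu>"
  shows "val_ge \<mu> (y - c)"
proof (rule ccontr)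
  assume not_ge: "\<not> val_ge \<mu> (y - c)"
  define d where "d = y - c"
  have d0: "d \<noteq> 0" using not_ge by (auto simp: d_def)
  obtain h where h: "y \<in> B" "h \<in> B"
    and eq: "y ^ q - c ^ q = d ^ q + of_nat q * d * (c ^ (q - 1) + d * h)"
    using prime_power_diff_val[OF c D] v by (auto simp: d_def)
  have cB: "c \<in> B" using c by (simp add: val_eq_0_iff)
  define g where "g = c ^ (q - 1) + d * h"
  have g: "g \<in> B" using h cB by (auto simp: g_def d_def)
  define \<delta> where "\<delta> = \<pi> powi \<mu> / d"
  have \<delta>: "\<delta> \<in> B" "\<delta> \<noteq> 0"
    using val_ge_iff_dvd_pi[OF _ not_ge] d0 by (auto simp: \<delta>_def d_def)
  have pq: "of_nat q = (\<pi> powi \<mu>) ^ (q - 1)"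
    by (metis \<mu> pi_power mult.commute power_int_of_nat power_int_mult)
  obtain q' where q': "q = Suc (Suc q')" using q_ge_2 by (metis add_2_eq_Suc le_Suc_ex)
  have \<mu>0: "\<mu> > 0" using \<mu> by (rule uniformizer_exponent_pos)
  have pil: "\<pi> powi \<mu> = \<delta> * d" using d0 by (simp add: \<delta>_def)
  have "y ^ q - c ^ q = d ^ q * (1 + \<delta> ^ (q - 1) * g)"
    unfolding eq g_def[symmetric] pq pil by (simp add: q' algebra_simps)
  then have one: "(y ^ q - c ^ q) / d ^ q - \<delta> * (\<delta> ^ q' * g) = 1"
    using d0 by (simp add: q' field_simps)
  \<comment> \<open>Value at least two suffices because \<open>q / (q - 1)\<close>, which is
    \<open>1 + 1 / (q - 1)\<close>, is at most two.\<close>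
  have "int N * v - \<mu> * int q \<ge> 0"
  proof -
    have "int N * 2 \<le> int N * v" using v by (intro mult_left_mono) auto
    moreover have "\<mu> * int q = int N + \<mu>" using \<mu> q' by (simp add: algebra_simps)
    moreover have "\<mu> \<le> int N"
      using mult_right_mono[of 1 "int (q - 1)" \<mu>] \<mu> \<mu>0 q' by simp
    ultimately show ?thesis by linarith
  qed
  then have "val_ge (\<mu> * int q) (y ^ q - c ^ q)" using D val_ge_mono by auto
  then have "(y ^ q - c ^ q) / (\<pi> powi \<mu>) ^ q \<in> B"
    by (simp add: val_ge_def power_int_mult)
  then have e: "(y ^ q - c ^ q) / (\<delta> * d) ^ q \<in> B" by (simp add: pil)
  define e where "e = (y ^ q - c ^ q) / (\<delta> * d) ^ q"
  have "(y ^ q - c ^ q) / d ^ q = e * \<delta> ^ q"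
    using \<delta>(2) by (simp add: e_def power_mult_distrib)
  from one[unfolded this, symmetric] have "1 = \<delta> * (e * \<delta> ^ Suc q' - \<delta> ^ q' * g)"
    by (simp only: q' power_Suc right_diff_distrib mult_ac)
  then have "inverse \<delta> = e * \<delta> ^ Suc q' - \<delta> ^ q' * g"
    using \<delta>(2) by (metis inverse_unique)
  also have "\<dots> \<in> B" using e g \<delta>(1) unfolding e_def by (intro diff_mem mult_mem power_mem)
  finally have "inverse \<delta> \<in> B" .
  then show False using not_ge by (simp add: \<delta>_def val_ge_def d_def)
qed

text \<open>If \<open>y - c\<close> has value above \<open>1 / (q - 1)\<close>, the linear term
  dominates and the value is \<open>v - 1\<close>. If every root has value exactly
  \<open>1 / (q - 1)\<close>, the product of all \<open>y - c\<close>, which is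
  \<open>x - c ^ q\<close> up to sign, gives \<open>q = (q - 1) * v\<close>; this forces
  \<open>q = v = 2\<close>, where \<open>1 / (q - 1)\<close> and \<open>v - 1\<close>
  coincide.\<close>

lemma prime_root_exists_near:
  assumes c: "val_eq 0 c" and D: "val_eq (int N * v) (x - c ^ q)" and v: "v \<ge> 2"
    and \<mu>: "int N = int (q - 1) * \<mu>"
  shows "\<exists>y. y ^ q = x \<and> val_eq (int N * (v - 1)) (y - c)"
proof -
  have q1: "q - 1 > 0" and q1': "int (q - 1) = int q - 1" using q_ge_2 by auto
  have \<mu>0: "\<mu> > 0" using \<mu> by (rule uniformizer_exponent_pos)
  have cB: "c \<in> B" using c by (simp add: val_eq_0_iff)
  have root: "\<exists>g. val_eq 0 g \<and> val_ge \<mu> (y - c) \<and>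
      x - c ^ q = (y - c) * \<pi> powi int N * (((y - c) / \<pi> powi \<mu>) ^ (q - 1) + g)" if y: "y ^ q = x" for y
  proof -
    have ge: "val_ge \<mu> (y - c)"
      using prime_root_val_ge[OF c _ v \<mu>, of y] val_eq_ge[OF D] y by simp
    obtain h where h: "y \<in> B" "h \<in> B"
      and eq: "x - c ^ q = (y - c) ^ q + of_nat q * (y - c) * (c ^ (q - 1) + (y - c) * h)"
      using prime_power_diff_val[OF c, of "int N * v" y] val_eq_ge[OF D] y v by auto
    have "val_ge (\<mu> + 0) ((y - c) * h)"
      using h ge by (intro val_ge_mult) (auto simp: val_ge_0_iff)
    then have g: "val_eq 0 (c ^ (q - 1) + (y - c) * h)"
      using val_eq_power[OF c, of "q - 1"] \<mu>0 by (intro val_eq_add) auto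
    have "(y - c) ^ q = (y - c) * (y - c) ^ (q - 1)" using q_pos by (simp flip: power_Suc)
    moreover have "(\<pi> powi \<mu>) ^ (q - 1) = \<pi> powi int N" "\<pi> powi int N = of_nat q"
      by (metis \<mu> mult.commute power_int_of_nat power_int_mult) (simp add: pi_power)
    ultimately have "x - c ^ q = (y - c) * \<pi> powi int N *
        (((y - c) / \<pi> powi \<mu>) ^ (q - 1) + (c ^ (q - 1) + (y - c) * h))"
      unfolding eq using q_nonzero by (simp add: power_divide distrib_left)
    with g ge show ?thesis by blast
  qed
  have near: "val_eq (int N * (v - 1)) (y - c)" if y: "y ^ q = x" and not_eq: "\<not> val_eq \<mu> (y - c)" for y
  proof -
    obtain g where g: "val_eq 0 g" "val_ge \<mu> (y - c)"
      "x - c ^ q = (y - c) * \<pi> powi int N * (((y - c) / \<pi> powi \<mu>) ^ (q - 1) + g)"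
      using root[OF y] by blast
    define \<tau> where "\<tau> = (y - c) / \<pi> powi \<mu>"
    have \<tau>: "\<tau> \<in> B" "\<tau> = 0 \<or> inverse \<tau> \<notin> B"
      using g(2) not_eq by (auto simp: \<tau>_def val_ge_def val_eq_def)
    have \<tau>': "\<tau> ^ (q - 1) = 0 \<or> inverse (\<tau> ^ (q - 1)) \<notin> B"
      using \<tau> root_mem[of "inverse \<tau>" "q - 1"] q1 by (auto simp: power_inverse)
    have "g + \<tau> ^ (q - 1) \<noteq> 0" "inverse (g + \<tau> ^ (q - 1)) \<in> B"
      using unit_add_nonunit[OF _ _ _ _ \<tau>', of g] g(1) \<tau>(1) by (auto simp: val_eq_0_iff)
    then have "val_eq 0 (\<tau> ^ (q - 1) + g)"
      using g(1) \<tau>(1) by (auto simp: val_eq_0_iff add.commute)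
    from val_eq_mult[OF val_eq_pi[of "int N"] this] have u: "val_eq (int N) (\<pi> powi int N * (\<tau> ^ (q - 1) + g))"
      by simp
    have "(x - c ^ q) / (\<pi> powi int N * (\<tau> ^ (q - 1) + g)) = y - c"
      using g(3) val_eq_nonzero[OF u] by (simp add: \<tau>_def field_simps)
    then show ?thesis using val_eq_divide[OF D u] by (simp add: right_diff_distrib)
  qed
  show ?thesis
  proof (cases "\<exists>y. y ^ q = x \<and> \<not> val_eq \<mu> (y - c)")
    case True
    then show ?thesis using near by blast
  next
    case False
    define f where "f = [:c, 1:] ^ q - [:x:]"
    have pf: "poly f z = (z + c) ^ q - x" for z by (simp add: f_def add.commute)
    have deg: "degree f = q" and lead: "lead_coeff f = 1"
    proof -
      have 1: "degree ([:c, 1:] ^ q) = q" by (simp add: degree_power_eq)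
      have 3: "lead_coeff ([:c, 1:] ^ q) = 1" by (simp only: lead_coeff_power) simp
      have 2: "degree [:x:] < degree ([:c, 1:] ^ q)" unfolding 1 using q_pos by simp
      have "f = - [:x:] + [:c, 1:] ^ q" by (simp add: f_def)
      moreover have "degree (- [:x:]) < degree ([:c, 1:] ^ q)" using 2 by simp
      ultimately show "degree f = q" "lead_coeff f = 1"
        using 1 3 degree_add_eq_right lead_coeff_add_le by metis+
    qed
    obtain z where f_eq: "f = (\<Prod>i<q. [:- z i, 1:])"
      using complex_poly_decompose'[of f] lead deg by (metis smult_1_left)
    have z: "val_eq \<mu> (- z i)" if "i < q" for i
    proof (rule val_eq_uminus)
      have "poly f (z i) = 0" unfolding f_eq poly_prod using that by (intro prod_zero) auto
      then have "(z i + c) ^ q = x" by (simp add: pf)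
      with False have "val_eq \<mu> (z i + c - c)" by blast
      then show "val_eq \<mu> (z i)" by simp
    qed
    have "val_eq (int j * \<mu>) (\<Prod>i<j. - z i)" if "j \<le> q" for j
      using that
    proof (induction j)
      case (Suc j)
      then show ?case using val_eq_mult[OF Suc.IH z[of j]] by (simp add: algebra_simps)
    qed (simp add: val_eq_one)
    from this[of q] have "val_eq (int q * \<mu>) (\<Prod>i<q. - z i)" by simp
    also have "(\<Prod>i<q. - z i) = poly f 0" by (simp add: f_eq poly_prod)
    also have "poly f 0 = - (x - c ^ q)" by (simp add: pf)
    finally have "val_eq (int q * \<mu>) (x - c ^ q)" using val_eq_uminus by fastforce
    then have eq: "int q * \<mu> = int N * v" using D val_eq_unique by auto
    then have "\<mu> * int q = \<mu> * (int (q - 1) * v)" unfolding \<mu> by (simp only: mult_ac)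
    then have eq': "int q = (int q - 1) * v" using \<mu>0 unfolding q1' by simp
    have "(int q - 1) * 2 \<le> (int q - 1) * v" using v q_ge_2 by (intro mult_left_mono) auto
    then have "q = 2" using eq' q_ge_2 by simp
    then have v2: "v = 2" using eq' by simp
    obtain y where y: "y ^ q = x"
      using q_pos nth_root_exists[of q x] by blast
    then show ?thesis using False v2 \<mu> \<open>q = 2\<close> by auto
  qed
qed

text \<open>Unless the near root already has value \<open>1 / (q - 1)\<close>, multiplying it by a
  primitive \<open>q\<close>-th root of unity \<open>z\<close> moves it by
  \<open>y * (z - 1)\<close>, whose smaller value then dominates.\<close>

lemma prime_root_exists_far:
  assumes c: "val_eq 0 c" and D: "val_eq (int N * v) (x - c ^ q)" and v: "v \<ge> 2"
    and \<mu>: "int N = int (q - 1) * \<mu>"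
  shows "\<exists>y. y ^ q = x \<and> val_eq \<mu> (y - c)"
proof (rule ccontr)
  assume none: "\<not> ?thesis"
  obtain y where y: "y ^ q = x" "val_eq (int N * (v - 1)) (y - c)"
    using prime_root_exists_near[OF assms] by blast
  have q1: "q - 1 > 0" using q_ge_2 by simp
  have \<mu>0: "\<mu> > 0" using \<mu> by (rule uniformizer_exponent_pos)
  have "int (q - 1) * \<mu> \<ge> 1 * \<mu>" using q1 \<mu>0 by (intro mult_right_mono) auto
  then have N\<mu>: "int N \<ge> \<mu>" using \<mu> by simp
  have "int N * 1 \<le> int N * (v - 1)" using v by (intro mult_left_mono) auto
  moreover have "int N * (v - 1) \<noteq> \<mu>" using none y by auto
  ultimately have lt: "\<mu> < int N * (v - 1)" using N\<mu> by simp
  define z where "z = cis (2 * pi / real q)"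
  have z: "z ^ q = 1" using q_pos by (simp add: z_def DeMoivre)
  have z1: "z \<noteq> 1"
    using cis_power_eq_1_imp_dvd[OF q_pos, of 1] q_ge_2 by (auto simp: z_def)
  have "val_eq 0 (c + (y - c))" using val_eq_add[OF c val_eq_ge[OF y(2)]] lt \<mu>0 by linarith
  then have "val_eq \<mu> (y * (z - 1))"
    using val_eq_mult[OF _ root_of_unity_val[OF \<mu> z z1], of 0 y] by simp
  then have "val_eq \<mu> (y * (z - 1) + (y - c))"
    using val_eq_ge[OF y(2)] lt by (rule val_eq_add)
  then have "val_eq \<mu> (y * z - c)" by (simp add: algebra_simps)
  moreover have "(y * z) ^ q = x" using y z by (simp add: power_mult_distrib)
  ultimately show False using none by blast
qed

end

section \<open>Roots near a given integer\<close>

text \<open>\<open>N\<close> is a common denominator of all values that occur: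
  \<open>1 / (q - 1)\<close> for roots of unity, and the slopes \<open>1 / (q ^ s * (q - 1))\<close>
  and \<open>1 / q ^ a0\<close>. The parameter \<open>w\<close> is the height of the polygon at
  abscissa \<open>0\<close>.\<close>

locale binomial_roots = prime_valuation B q N \<pi> for B q N \<pi> +
  fixes k w :: nat and m c :: int
  assumes N_eq: "N = q ^ k * (q - 1)" and c_unit: "\<not> int q dvd c"
    and val_top: "val_eq (int N * int w) (of_int m - of_int c ^ (q ^ k))"
begin

lemma N_eq': "int N = int (q - 1) * int (q ^ k)"
  by (simp add: N_eq mult.commute)

lemma val_c_power: "val_eq 0 (of_int c ^ j)"
  using val_eq_power[OF val_eq_not_dvd[OF c_unit], of j] by simp

text \<open>As long as the values are at most one, extracting any \<open>q\<close>-th root divides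
  the value by exactly \<open>q\<close>, so no choice of root matters here.\<close>

lemma descend:
  assumes "val_eq (int (q ^ a) * v) (y ^ (q ^ a) - of_int c ^ (q ^ a))"
    and v: "v > 0" "int (q ^ a) * v \<le> int N" and "i \<le> a"
  shows "val_eq (int (q ^ i) * v) (y ^ (q ^ i) - of_int c ^ (q ^ i))"
  using \<open>i \<le> a\<close>
proof (induction rule: inc_induct)
  case base
  show ?case by fact
next
  case (step j)
  have "q ^ Suc j \<le> q ^ a" using step.hyps q_pos by (intro power_increasing) auto
  then have "int (q ^ Suc j) * v \<le> int (q ^ a) * v" using v
    by (intro mult_right_mono) (simp_all only: of_nat_le_iff less_imp_le)
  also have "int (q ^ Suc j) * v = int q * (int (q ^ j) * v)" by (simp add: mult.assoc)
  finally have le: "int q * (int (q ^ j) * v) \<le> int N" using v(2) by (rule order_trans)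
  have eq: "z ^ (q ^ Suc j) = (z ^ (q ^ j)) ^ q" for z :: complex
    by (simp add: mult.commute flip: power_mult)
  show ?case
    using step.IH v q_pos le unfolding eq
    by (intro prime_root_val_small[OF val_c_power]) (simp_all add: mult.assoc)
qed

text \<open>Each near root lowers the value by one. The bound on \<open>a0\<close> keeps the value
  at least two before every extraction, as \<open>prime_root_exists_near\<close> demands.\<close>

lemma near_chain:
  assumes a0: "k + 1 \<le> w + a0" and "a0 \<le> a" "a \<le> k"
  shows "\<exists>y. y ^ (q ^ (k - a)) = of_int m \<and>
    (\<forall>b. a \<le> b \<and> b \<le> k \<longrightarrow>
      val_eq (int N * (int w + int b - int k)) (y ^ (q ^ (b - a)) - of_int c ^ (q ^ b)))"
  using \<open>a \<le> k\<close>
proof (induction rule: inc_induct)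
  case base
  have "b = k" if "k \<le> b \<and> b \<le> k" for b using that by auto
  then show ?case using val_top by (intro exI[of _ "of_int m"]) auto
next
  case (step j)
  then obtain y where y: "y ^ (q ^ (k - Suc j)) = of_int m"
    "\<And>b. Suc j \<le> b \<Longrightarrow> b \<le> k \<Longrightarrow>
      val_eq (int N * (int w + int b - int k)) (y ^ (q ^ (b - Suc j)) - of_int c ^ (q ^ b))"
    by blast
  have cp: "of_int c ^ (q ^ Suc j) = (of_int c ^ (q ^ j) :: complex) ^ q"
    by (simp add: mult.commute flip: power_mult)
  have "val_eq (int N * (int w + int (Suc j) - int k)) (y - (of_int c ^ (q ^ j)) ^ q)"
    using y(2)[of "Suc j"] step.hyps unfolding cp by simp
  moreover have "int w + int (Suc j) - int k \<ge> 2" using a0 assms(2) step.hyps by auto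
  ultimately obtain z where z: "z ^ q = y"
    "val_eq (int N * (int w + int (Suc j) - int k - 1)) (z - of_int c ^ (q ^ j))"
    using prime_root_exists_near[OF val_c_power _ _ N_eq'] by blast
  have zp: "z ^ (q ^ (b - j)) = y ^ (q ^ (b - Suc j))" if "Suc j \<le> b" for b
  proof -
    have "b - j = Suc (b - Suc j)" using that by simp
    then show ?thesis by (simp add: power_mult z(1))
  qed
  show ?case
  proof (intro exI[of _ z] conjI allI impI)
    show "z ^ (q ^ (k - j)) = of_int m" using zp[of k] y(1) step.hyps by simp
    fix b assume b: "j \<le> b \<and> b \<le> k"
    show "val_eq (int N * (int w + int b - int k)) (z ^ (q ^ (b - j)) - of_int c ^ (q ^ b))"
    proof (cases "b = j")
      case True
      then show ?thesis using z(2) by (simp add: algebra_simps)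
    next
      case False
      then show ?thesis using y(2)[of b] zp[of b] b by simp
    qed
  qed
qed

text \<open>Near roots down to level \<open>s + 1\<close>, one far root with value
  \<open>1 / (q - 1)\<close> at level \<open>s\<close>, arbitrary roots below. Hence
  \<open>x - c\<close> has value \<open>1 / (q ^ s * (q - 1))\<close>, the slope of side
  \<open>s\<close>.\<close>

lemma side_root:
  assumes "k + 1 \<le> w + a0" and "a0 \<le> s" "s < k"
  obtains x where "x ^ (q ^ k) = of_int m"
    "\<And>a. s < a \<Longrightarrow> a \<le> k \<Longrightarrow>
      val_eq (int N * (int w + int a - int k)) (x ^ (q ^ a) - of_int c ^ (q ^ a))"
    "\<And>a. a \<le> s \<Longrightarrow> val_eq (int (q ^ (k - s + a))) (x ^ (q ^ a) - of_int c ^ (q ^ a))"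
proof -
  obtain y where y: "y ^ (q ^ (k - Suc s)) = of_int m"
    "\<And>b. Suc s \<le> b \<Longrightarrow> b \<le> k \<Longrightarrow>
      val_eq (int N * (int w + int b - int k)) (y ^ (q ^ (b - Suc s)) - of_int c ^ (q ^ b))"
    using near_chain[OF assms(1), of "Suc s"] assms by auto
  have cp: "of_int c ^ (q ^ Suc s) = (of_int c ^ (q ^ s) :: complex) ^ q"
    by (simp add: mult.commute flip: power_mult)
  have "val_eq (int N * (int w + int (Suc s) - int k)) (y - (of_int c ^ (q ^ s)) ^ q)"
    using y(2)[of "Suc s"] assms unfolding cp by simp
  moreover have "int w + int (Suc s) - int k \<ge> 2" using assms by auto
  ultimately obtain z where z: "z ^ q = y" "val_eq (int (q ^ k)) (z - of_int c ^ (q ^ s))"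
    using prime_root_exists_far[OF val_c_power _ _ N_eq'] by blast
  obtain x where x: "x ^ (q ^ s) = z" using nth_root_exists[of "q ^ s" z] q_pos by auto
  have xy: "x ^ (q ^ a) = y ^ (q ^ (a - Suc s))" if "s < a" for a
  proof -
    have "q ^ a = q ^ s * (q * q ^ (a - Suc s))" using that by (simp flip: power_add power_Suc)
    then show ?thesis by (simp only: power_mult x z(1))
  qed
  have ks: "q ^ s * q ^ (k - s) = q ^ k" using assms by (simp flip: power_add)
  show thesis
  proof (rule that)
    show "x ^ (q ^ k) = of_int m" using xy[of k] y(1) assms by simp
    show "val_eq (int N * (int w + int a - int k)) (x ^ (q ^ a) - of_int c ^ (q ^ a))"
      if "s < a" "a \<le> k" for a
      using y(2)[of a] xy[of a] that by simp
    show "val_eq (int (q ^ (k - s + a))) (x ^ (q ^ a) - of_int c ^ (q ^ a))" if "a \<le> s" for a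
    proof -
      have "val_eq (int (q ^ a) * int (q ^ (k - s))) (x ^ (q ^ a) - of_int c ^ (q ^ a))"
      proof (rule descend[OF _ _ _ that])
        show "val_eq (int (q ^ s) * int (q ^ (k - s))) (x ^ (q ^ s) - of_int c ^ (q ^ s))"
          using z(2) unfolding x of_nat_mult[symmetric] ks .
        show "int (q ^ s) * int (q ^ (k - s)) \<le> int N"
          using q_ge_2 unfolding of_nat_mult[symmetric] ks by (simp add: N_eq)
      qed (use q_pos in auto)
      then show ?thesis by (simp add: power_add mult.commute)
    qed
  qed
qed

text \<open>Near roots all the way to level \<open>a0\<close>. For \<open>a0 > 0\<close> the value
  there is exactly one and \<open>descend\<close> gives \<open>1 / q ^ a0\<close> for
  \<open>x - c\<close>; for \<open>a0 = 0\<close> the value of \<open>x - c\<close> is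
  \<open>w - k\<close>.\<close>

lemma first_side_root:
  assumes "k + 1 \<le> w + a0" "a0 \<le> k" and a0: "a0 = 0 \<or> w + a0 = k + 1"
  obtains x where "x ^ (q ^ k) = of_int m"
    "\<And>a. a0 \<le> a \<Longrightarrow> a \<le> k \<Longrightarrow>
      val_eq (int N * (int w + int a - int k)) (x ^ (q ^ a) - of_int c ^ (q ^ a))"
    "a0 > 0 \<Longrightarrow> val_eq (int (q ^ (k - a0) * (q - 1))) (x - of_int c)"
proof -
  obtain y where y: "y ^ (q ^ (k - a0)) = of_int m"
    "\<And>b. a0 \<le> b \<Longrightarrow> b \<le> k \<Longrightarrow>
      val_eq (int N * (int w + int b - int k)) (y ^ (q ^ (b - a0)) - of_int c ^ (q ^ b))"
    using near_chain[OF assms(1), of a0] assms by auto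
  obtain x where x: "x ^ (q ^ a0) = y" using nth_root_exists[of "q ^ a0" y] q_pos by auto
  have xy: "x ^ (q ^ a) = y ^ (q ^ (a - a0))" if "a0 \<le> a" for a
  proof -
    have "q ^ a = q ^ a0 * q ^ (a - a0)" using that by (simp flip: power_add)
    then show ?thesis by (simp only: power_mult x)
  qed
  have ka: "q ^ a0 * q ^ (k - a0) = q ^ k" using assms by (simp flip: power_add)
  have N: "q ^ a0 * (q ^ (k - a0) * (q - 1)) = N"
    using ka by (simp add: N_eq flip: mult.assoc)
  show thesis
  proof (rule that)
    show "x ^ (q ^ k) = of_int m" using xy[of k] y(1) assms by simp
    show "val_eq (int N * (int w + int a - int k)) (x ^ (q ^ a) - of_int c ^ (q ^ a))"
      if "a0 \<le> a" "a \<le> k" for a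
      using y(2)[of a] xy[of a] that by simp
    assume "a0 > 0"
    then have "int w + int a0 - int k = 1" using a0 by auto
    then have "val_eq (int (q ^ a0) * int (q ^ (k - a0) * (q - 1))) (x ^ (q ^ a0) - of_int c ^ (q ^ a0))"
      using y(2)[of a0] assms(2) unfolding N of_nat_mult[symmetric] by (simp add: x)
    moreover have "int (q ^ a0) * int (q ^ (k - a0) * (q - 1)) \<le> int N"
      unfolding of_nat_mult[symmetric] N by simp
    moreover have "int (q ^ (k - a0) * (q - 1)) > 0" using q_ge_2 by simp
    ultimately show "val_eq (int (q ^ (k - a0) * (q - 1))) (x - of_int c)"
      using descend[of a0 _ x 0] by fastforce
  qed
qed

end

section \<open>The basis elements\<close>

text \<open>A geometric sum in place of a quotient, so that the same formula makes sense for
  polynomials and for their values.\<close>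

definition cofactor :: "nat \<Rightarrow> nat \<Rightarrow> nat \<Rightarrow> 'a::comm_ring_1 \<Rightarrow> 'a \<Rightarrow> 'a" where
  "cofactor p k a c x = (\<Sum>i<p ^ (k - a). (c ^ (p ^ a)) ^ (p ^ (k - a) - Suc i) * (x ^ (p ^ a)) ^ i)"

lemma cofactor_mult:
  assumes "a \<le> k"
  shows "(x ^ (p ^ a) - c ^ (p ^ a)) * cofactor p k a c x = x ^ (p ^ k) - c ^ (p ^ k)"
proof -
  have "p ^ k = p ^ a * p ^ (k - a)" using assms by (simp flip: power_add)
  then show ?thesis
    by (simp only: cofactor_def power_diff_sumr2 power_mult)
qed

text \<open>The basis element of degree \<open>i\<close> is \<open>(X - c)\<^sup>t \<Psi>\<^sub>a / p\<^bsup>k - a\<^esup>\<close>, where \<open>a\<close> is the level and \<open>t\<close> the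
  excess of \<open>i\<close>, and \<open>\<Psi>\<^sub>a\<close> is the cofactor of \<open>X ^ (p ^ a) - c ^ (p ^ a)\<close> in
  \<open>X ^ (p ^ k) - c ^ (p ^ k)\<close>.\<close>

definition level :: "nat \<Rightarrow> nat \<Rightarrow> nat \<Rightarrow> nat \<Rightarrow> nat" where
  "level p k a0 i = (LEAST a. a0 \<le> a \<and> p ^ k - i \<le> p ^ a)"

definition excess :: "nat \<Rightarrow> nat \<Rightarrow> nat \<Rightarrow> nat \<Rightarrow> nat" where
  "excess p k a0 i = p ^ level p k a0 i - (p ^ k - i)"

definition basis_elt :: "nat \<Rightarrow> nat \<Rightarrow> nat \<Rightarrow> complex \<Rightarrow> nat \<Rightarrow> complex \<Rightarrow> complex" where
  "basis_elt p k a0 c i x =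
     (x - c) ^ excess p k a0 i * cofactor p k (level p k a0 i) c x / of_nat p ^ (k - level p k a0 i)"

lemma level_props:
  assumes "a0 \<le> k"
  shows "a0 \<le> level p k a0 i" "p ^ k - i \<le> p ^ level p k a0 i" "level p k a0 i \<le> k"
proof -
  have k: "a0 \<le> k \<and> p ^ k - i \<le> p ^ k" using assms by simp
  from LeastI[of "\<lambda>a. a0 \<le> a \<and> p ^ k - i \<le> p ^ a", OF k] Least_le[of "\<lambda>a. a0 \<le> a \<and> p ^ k - i \<le> p ^ a", OF k]
  show "a0 \<le> level p k a0 i" "p ^ k - i \<le> p ^ level p k a0 i" "level p k a0 i \<le> k"
    unfolding level_def by auto
qed

lemma level_antimono:
  assumes "a0 \<le> k" "i \<le> j"
  shows "level p k a0 j \<le> level p k a0 i"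
  unfolding level_def[of _ _ _ j]
  using level_props(1,2)[OF assms(1), of p i] assms(2) by (intro Least_le) auto

lemma excess_add:
  assumes "a0 \<le> k"
  shows "excess p k a0 i + (p ^ k - i) = p ^ level p k a0 i"
  using level_props(2)[OF assms, of p i] by (simp add: excess_def)

lemma excess_lt:
  assumes "a0 \<le> k" "i < p ^ k"
  shows "excess p k a0 i < p ^ level p k a0 i"
  using excess_add[OF assms(1), of p i] assms(2) by linarith

text \<open>Minimality of the level. The bound is the length of the side ending at
  \<open>p ^ level\<close>, so at a root on that side the power of \<open>x - c\<close> stays below
  value one.\<close>

lemma excess_lt':
  assumes "a0 \<le> k" "a0 < level p k a0 i"
  shows "excess p k a0 i < p ^ (level p k a0 i - 1) * (p - 1)"
proof -
  define l where "l = level p k a0 i - 1"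
  have l: "level p k a0 i = Suc l" "a0 \<le> l" using assms(2) by (auto simp: l_def)
  have "\<not> p ^ k - i \<le> p ^ l"
    using not_less_Least[of l "\<lambda>a. a0 \<le> a \<and> p ^ k - i \<le> p ^ a"] l
    by (auto simp: level_def)
  moreover have "excess p k a0 i + (p ^ k - i) = p ^ l * p"
    using excess_add[OF assms(1), of p i] by (simp add: l)
  ultimately show ?thesis by (simp add: l diff_mult_distrib2)
qed

lemma excess_less_iff:
  assumes "a0 \<le> k" "i < p ^ k" "j < p ^ k" "level p k a0 i = level p k a0 j"
  shows "excess p k a0 i < excess p k a0 j \<longleftrightarrow> i < j"
proof -
  have "excess p k a0 i + (p ^ k - i) = excess p k a0 j + (p ^ k - j)"
    using excess_add[OF assms(1), of p] assms(4) by simp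
  then show ?thesis using assms(2,3) by linarith
qed

text \<open>Recovers the index from its level and excess; \<open>dvd_two_lowest_levels\<close> needs
  two indices with a common excess.\<close>

lemma level_index:
  assumes "a0 \<le> a" "a \<le> k" "p > 0" and t: "a = a0 \<and> t < p ^ a \<or> a0 < a \<and> t < p ^ (a - 1) * (p - 1)"
  shows "p ^ k - p ^ a + t < p ^ k" "level p k a0 (p ^ k - p ^ a + t) = a"
    "excess p k a0 (p ^ k - p ^ a + t) = t"
proof -
  have le: "p ^ a \<le> p ^ k" using assms by (intro power_increasing) auto
  have pa: "p ^ a = p ^ (a - 1) + p ^ (a - 1) * (p - 1)" if "a0 < a"
  proof -
    have "p ^ a = p ^ (a - 1) * p" using that by (metis Suc_diff_1 bot_nat_0.extremum_strict gr0I power_Suc2)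
    also have "\<dots> = p ^ (a - 1) * (1 + (p - 1))" using assms(3) by simp
    finally show ?thesis by (simp only: distrib_left mult_1_right)
  qed
  have ta: "t < p ^ a" using t pa by auto
  then show "p ^ k - p ^ a + t < p ^ k" using le by simp
  have eq: "p ^ k - (p ^ k - p ^ a + t) = p ^ a - t" using le ta by simp
  show lev: "level p k a0 (p ^ k - p ^ a + t) = a"
    unfolding level_def eq
  proof (rule Least_equality)
    fix l assume l: "a0 \<le> l \<and> p ^ a - t \<le> p ^ l"
    show "a \<le> l"
    proof (rule ccontr)
      assume "\<not> a \<le> l"
      then have "a0 < a" "p ^ l \<le> p ^ (a - 1)" using l assms(3) by (auto intro!: power_increasing)
      then show False using pa t l by auto
    qed
  qed (use assms in auto)
  show "excess p k a0 (p ^ k - p ^ a + t) = t"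
    unfolding excess_def lev eq using ta by simp
qed

section \<open>Valuations of the basis elements at the constructed roots\<close>

context binomial_roots
begin

abbreviation "lev a0 i \<equiv> level q k a0 i"
abbreviation "exc a0 i \<equiv> excess q k a0 i"
abbreviation "elt a0 i x \<equiv> basis_elt q k a0 (of_int c) i x"

lemma cofactor_val:
  assumes x: "x ^ (q ^ k) = of_int m" and a: "a \<le> k"
    and v: "val_eq v (x ^ (q ^ a) - of_int c ^ (q ^ a))"
  shows "val_eq (int N * (int w + int a - int k) - v) (cofactor q k a (of_int c) x / of_nat q ^ (k - a))"
proof -
  have "cofactor q k a (of_int c) x = (of_int m - of_int c ^ (q ^ k)) / (x ^ (q ^ a) - of_int c ^ (q ^ a))"
    using cofactor_mult[OF a, of x q "of_int c"] val_eq_nonzero[OF v] x by (simp add: field_simps)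
  then have 1: "val_eq (int N * int w - v) (cofactor q k a (of_int c) x)"
    using val_eq_divide[OF val_top v] by simp
  have "int N * int w - v - int (k - a) * int N = int N * (int w + int a - int k) - v"
    using a by (simp add: of_nat_diff algebra_simps)
  with val_eq_divide[OF 1 val_eq_power[OF val_eq_prime, of "k - a"]] show ?thesis by simp
qed

lemma elt_val:
  assumes "a0 \<le> k" and x: "x ^ (q ^ k) = of_int m" and f: "val_eq f (x - of_int c)"
    and v: "val_eq v (x ^ (q ^ lev a0 i) - of_int c ^ (q ^ lev a0 i))"
  shows "val_eq (int (exc a0 i) * f + (int N * (int w + int (lev a0 i) - int k) - v)) (elt a0 i x)"
  using val_eq_mult[OF val_eq_power[OF f, of "exc a0 i"] cofactor_val[OF x _ v]] level_props(3)[OF assms(1)]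
  by (simp add: basis_elt_def)

text \<open>Above level \<open>s\<close> the normalised cofactor is a unit, so only the power of
  \<open>x - c\<close> counts. At a level \<open>a \<le> s\<close> the divisor
  \<open>x ^ (q ^ a) - c ^ (q ^ a)\<close> has value at most one, below \<open>w + a - k\<close>;
  the difference is at least one for \<open>a > a0\<close>, but may fall short of one at
  \<open>a0\<close>.\<close>

lemma elt_val_side:
  assumes "a0 \<le> k" "k + 1 \<le> w + a0" "a0 \<le> s" "s < k"
  obtains x where "x ^ (q ^ k) = of_int m"
    "\<And>i. s < lev a0 i \<Longrightarrow> val_eq (int (exc a0 i * q ^ (k - s))) (elt a0 i x)"
    "\<And>i. a0 < lev a0 i \<Longrightarrow> lev a0 i \<le> s \<Longrightarrow> val_ge (int N) (elt a0 i x)"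
    "\<And>i. lev a0 i = a0 \<Longrightarrow>
      val_ge (int N * (int w + int a0 - int k) - int (q ^ a0 * q ^ (k - s))) (elt a0 i x)"
proof -
  obtain x where x: "x ^ (q ^ k) = of_int m"
    "\<And>a. s < a \<Longrightarrow> a \<le> k \<Longrightarrow>
      val_eq (int N * (int w + int a - int k)) (x ^ (q ^ a) - of_int c ^ (q ^ a))"
    "\<And>a. a \<le> s \<Longrightarrow> val_eq (int (q ^ (k - s + a))) (x ^ (q ^ a) - of_int c ^ (q ^ a))"
    using side_root[OF assms(2-4)] by blast
  have f: "val_eq (int (q ^ (k - s))) (x - of_int c)" using x(3)[of 0] by simp
  have far: "val_eq (int (exc a0 i) * int (q ^ (k - s)) +
      (int N * (int w + int (lev a0 i) - int k) - int (q ^ (k - s + lev a0 i)))) (elt a0 i x)"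
    if "lev a0 i \<le> s" for i
    using elt_val[OF assms(1) x(1) f x(3)[OF that]] .
  show thesis
  proof (rule that[OF x(1)])
    fix i assume "s < lev a0 i"
    then show "val_eq (int (exc a0 i * q ^ (k - s))) (elt a0 i x)"
      using elt_val[OF assms(1) x(1) f x(2), of i] level_props(3)[OF assms(1)] by simp
  next
    fix i assume i: "a0 < lev a0 i" "lev a0 i \<le> s"
    have "q ^ (k - s + lev a0 i) \<le> q ^ k" using i assms q_pos by (intro power_increasing) auto
    also have "q ^ k \<le> N" using q_ge_2 by (simp add: N_eq)
    finally have "int (q ^ (k - s + lev a0 i)) \<le> int N" by simp
    moreover have "int N * (int w + int (lev a0 i) - int k) \<ge> int N * 2"
      using i assms by (intro mult_left_mono) auto
    moreover have "0 \<le> int (exc a0 i) * int (q ^ (k - s))" by simp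
    ultimately have "int N \<le> int (exc a0 i) * int (q ^ (k - s)) +
      (int N * (int w + int (lev a0 i) - int k) - int (q ^ (k - s + lev a0 i)))" by linarith
    then show "val_ge (int N) (elt a0 i x)"
      by (rule val_ge_mono[OF val_eq_ge[OF far[OF i(2)]]])
  next
    fix i assume i: "lev a0 i = a0"
    show "val_ge (int N * (int w + int a0 - int k) - int (q ^ a0 * q ^ (k - s))) (elt a0 i x)"
      using far[of i] assms(3) unfolding i
      by (intro val_ge_mono[OF val_eq_ge]) (auto simp: power_add mult.commute)
  qed
qed

text \<open>The two bounds on \<open>f\<close> say that \<open>(x - c) ^ t\<close> stays below value
  one for \<open>t < q ^ a0\<close> and reaches it at \<open>t = q ^ a0\<close>. All normalised
  cofactors of level at least \<open>a0\<close> are units here.\<close>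

lemma elt_val_first:
  assumes "a0 \<le> k" "k + 1 \<le> w + a0" "a0 = 0 \<or> w + a0 = k + 1"
  obtains x f where "x ^ (q ^ k) = of_int m" "f > 0" "int N \<le> f * int (q ^ a0)"
    "f * (int (q ^ a0) - 1) < int N" "val_eq f (x - of_int c)"
    "\<And>a. a0 \<le> a \<Longrightarrow> a \<le> k \<Longrightarrow>
      val_eq (int N * (int w + int a - int k)) (x ^ (q ^ a) - of_int c ^ (q ^ a))"
    "\<And>a. a0 \<le> a \<Longrightarrow> a \<le> k \<Longrightarrow> val_eq 0 (cofactor q k a (of_int c) x / of_nat q ^ (k - a))"
    "\<And>i. val_eq (int (exc a0 i) * f) (elt a0 i x)"
proof -
  obtain x where x: "x ^ (q ^ k) = of_int m"
    "\<And>a. a0 \<le> a \<Longrightarrow> a \<le> k \<Longrightarrow>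
      val_eq (int N * (int w + int a - int k)) (x ^ (q ^ a) - of_int c ^ (q ^ a))"
    "a0 > 0 \<Longrightarrow> val_eq (int (q ^ (k - a0) * (q - 1))) (x - of_int c)"
    using first_side_root[OF assms(2,1,3)] by blast
  have "\<exists>f. f > 0 \<and> int N \<le> f * int (q ^ a0) \<and> f * (int (q ^ a0) - 1) < int N \<and> val_eq f (x - of_int c)"
  proof (cases "a0 = 0")
    case True
    have "int N * 1 \<le> int N * (int w - int k)" using assms True by (intro mult_left_mono) auto
    then show ?thesis
      using x(2)[of 0] True N_pos by (intro exI[of _ "int N * (int w - int k)"]) auto
  next
    case False
    have "q ^ a0 * q ^ (k - a0) = q ^ k" using assms by (simp flip: power_add)
    then have "q ^ (k - a0) * (q - 1) * q ^ a0 = N" by (simp add: N_eq mult_ac)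
    moreover define f where "f = int (q ^ (k - a0) * (q - 1))"
    ultimately have "f * int (q ^ a0) = int N" by (metis of_nat_mult)
    moreover have "f > 0" using q_ge_2 by (simp add: f_def)
    moreover have "val_eq f (x - of_int c)" using x(3) False by (simp add: f_def)
    ultimately show ?thesis by (intro exI[of _ f]) (simp add: right_diff_distrib)
  qed
  then obtain f where f: "f > 0" "int N \<le> f * int (q ^ a0)" "f * (int (q ^ a0) - 1) < int N"
    "val_eq f (x - of_int c)" by blast
  show thesis
  proof (rule that[OF x(1) f x(2)])
    show "val_eq 0 (cofactor q k a (of_int c) x / of_nat q ^ (k - a))" if "a0 \<le> a" "a \<le> k" for a
      using cofactor_val[OF x(1) that(2) x(2)[OF that]] by simp
    show "val_eq (int (exc a0 i) * f) (elt a0 i x)" for i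
      using elt_val[OF assms(1) x(1) f(4) x(2)] level_props[OF assms(1)] by simp
  qed
qed

end

section \<open>Saturation of the lattice at the residue characteristic\<close>

context binomial_roots
begin

lemma val_eq_sum_not_ge:
  assumes "val_eq v (f i)" "v < int N" "i \<in> I" "finite I"
    and "\<And>j. j \<in> I \<Longrightarrow> j \<noteq> i \<Longrightarrow> val_ge (v + 1) (f j)"
  shows "\<not> val_ge (int N) (sum f I)"
proof -
  have "val_eq v (sum f I)" by (rule val_eq_sum[where f = f, OF assms(4,3,1,5)])
  from val_eq_imp_le[OF this, of "int N"] show ?thesis using assms(2) by auto
qed

lemma val_ge_dvd_mult: "int q dvd b \<Longrightarrow> val_ge 0 x \<Longrightarrow> val_ge (int N) (of_int b * x)"
  using val_ge_mult[OF val_ge_dvd, of b 0 x] by simp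

lemma val_ge_of_int_mult: "val_ge v x \<Longrightarrow> val_ge v (of_int b * x)"
  using val_ge_mult[OF val_ge_of_int, of v x b] by simp

lemma val_eq_not_dvd_mult: "\<not> int q dvd b \<Longrightarrow> val_eq v x \<Longrightarrow> val_eq v (of_int b * x)"
  using val_eq_mult[OF val_eq_not_dvd, of b v x] by simp

text \<open>Evaluated at a root on side \<open>s\<close> of the Newton polygon of \<open>(X + c) ^ (q ^ k) - m\<close>, the basis
  elements of level \<open>s + 1\<close> have distinct valuations below \<open>1\<close>, while those of lower level
  nearly vanish. The slack \<open>g\<close> is needed as long as the elements of the lowest level are not under control.\<close>

lemma dvd_high_levels:
  fixes b :: "nat \<Rightarrow> int"
  assumes a0: "a0 \<le> k" "k + 1 \<le> w + a0"
    and int: "\<And>x. x ^ (q ^ k) = of_int m \<Longrightarrow> val_ge (int N) (\<Sum>i<q ^ k. of_int (b i) * elt a0 i x)"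
    and g: "g \<le> q ^ a0" "g = q ^ a0 \<or> (\<forall>i<q ^ k. lev a0 i = a0 \<longrightarrow> int q dvd b i) \<or> k + 2 \<le> w + a0"
  shows "i < q ^ k \<Longrightarrow> a0 < lev a0 i \<Longrightarrow> exc a0 i + g < q ^ (lev a0 i - 1) * (q - 1) \<Longrightarrow> int q dvd b i"
proof (induction i rule: less_induct)
  case (less i)
  show ?case
  proof (rule ccontr)
    assume bad: "\<not> int q dvd b i"
    define s where "s = lev a0 i - 1"
    \<comment> \<open>Side \<open>s\<close> has length \<open>e\<close> and slope
      \<open>f / N\<close>; its height is one, whence \<open>f * e = N\<close>.\<close>
    define e where "e = q ^ s * (q - 1)"
    define f where "f = q ^ (k - s)"
    have s: "lev a0 i = Suc s" "a0 \<le> s" "s < k"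
      using less.prems level_props(3)[OF a0(1), of q i] by (auto simp: s_def)
    have f0: "f > 0" using q_pos by (simp add: f_def)
    have "q ^ s * q ^ (k - s) = q ^ k" using s by (simp flip: power_add)
    then have fe: "f * e = N" by (simp add: f_def e_def N_eq mult_ac)
    have t: "exc a0 i + g < e" using less.prems by (simp add: s e_def)
    obtain x where x: "x ^ (q ^ k) = of_int m"
      "\<And>j. s < lev a0 j \<Longrightarrow> val_eq (int (exc a0 j * f)) (elt a0 j x)"
      "\<And>j. a0 < lev a0 j \<Longrightarrow> lev a0 j \<le> s \<Longrightarrow> val_ge (int N) (elt a0 j x)"
      "\<And>j. lev a0 j = a0 \<Longrightarrow> val_ge (int N * (int w + int a0 - int k) - int (q ^ a0 * f)) (elt a0 j x)"
      using elt_val_side[OF a0 s(2,3)] unfolding f_def by metis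
    have low: "val_ge (int N - int (q ^ a0 * f)) (elt a0 j x)" if "lev a0 j = a0" for j
    proof (rule val_ge_mono[OF x(4)[OF that]])
      have "int N * 1 \<le> int N * (int w + int a0 - int k)" using a0 by (intro mult_left_mono) auto
      then show "int N - int (q ^ a0 * f) \<le> int N * (int w + int a0 - int k) - int (q ^ a0 * f)" by simp
    qed
    have "q ^ a0 * f \<le> q ^ s * f" using s q_pos by (intro mult_right_mono power_increasing) auto
    also have "\<dots> = q ^ k" using s by (simp add: f_def flip: power_add)
    also have "q ^ k \<le> N" using q_ge_2 by (simp add: N_eq)
    finally have qf: "q ^ a0 * f \<le> N" .
    have ge0: "val_ge 0 (elt a0 j x)" for j
    proof -
      consider "s < lev a0 j" | "a0 < lev a0 j" "lev a0 j \<le> s" | "lev a0 j = a0"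
        using level_props(1)[OF a0(1), of q j] by linarith
      then show ?thesis
      proof cases
        case 1
        show ?thesis using val_ge_mono[OF val_eq_ge[OF x(2)[OF 1]], of 0] by simp
      next
        case 2
        show ?thesis using val_ge_mono[OF x(3)[OF 2], of 0] by simp
      next
        case 3
        have "0 \<le> int N - int (q ^ a0 * f)" using qf by linarith
        then show ?thesis by (rule val_ge_mono[OF low[OF 3]])
      qed
    qed
    define v where "v = int (exc a0 i * f)"
    have next_le: "v + 1 \<le> int (u * f)" if "exc a0 i < u" for u
    proof -
      have "Suc (exc a0 i) * f \<le> u * f" using that by (intro mult_right_mono) auto
      then have "exc a0 i * f + 1 \<le> u * f" using f0 by simp
      then show ?thesis unfolding v_def by linarith
    qed
    have vN: "v + 1 \<le> int N" using next_le[of e] t by (simp add: fe[symmetric] mult.commute)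
    have "\<not> val_ge (int N) (\<Sum>j<q ^ k. of_int (b j) * elt a0 j x)"
    proof (rule val_eq_sum_not_ge[where i = i and v = v])
      show "val_eq v (of_int (b i) * elt a0 i x)"
        unfolding v_def using bad x(2)[of i] s by (intro val_eq_not_dvd_mult) auto
      show "v < int N" using vN by simp
      show "i \<in> {..<q ^ k}" using less.prems by simp
      fix j assume j: "j \<in> {..<q ^ k}" "j \<noteq> i"
      show "val_ge (v + 1) (of_int (b j) * elt a0 j x)"
      proof (cases "int q dvd b j")
        case True
        then show ?thesis using val_ge_mono[OF val_ge_dvd_mult[OF True ge0] vN] by simp
      next
        case False
        have "val_ge (v + 1) (elt a0 j x)"
        proof -
          consider "lev a0 j = lev a0 i" | "lev a0 i < lev a0 j" | "a0 < lev a0 j" "lev a0 j \<le> s" | "lev a0 j = a0" "a0 \<le> s"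
            using level_props(1)[OF a0(1), of q j] s by linarith
          then show ?thesis
          proof cases
            case 1
            have "\<not> j < i"
            proof
              assume "j < i"
              then have "exc a0 j < exc a0 i" using excess_less_iff[OF a0(1) _ _ 1] j less.prems by simp
              then show False using less.IH[OF \<open>j < i\<close>] j less.prems False 1 by auto
            qed
            then have "exc a0 i < exc a0 j"
              using excess_less_iff[OF a0(1) _ _ 1[symmetric]] j less.prems by simp
            from next_le[OF this] show ?thesis
              using val_ge_mono[OF val_eq_ge[OF x(2)[of j]]] 1 s by simp
          next
            \<comment> \<open>A coefficient on a higher level that is not yet known to be divisible
              sits within \<open>g\<close> of the end of its level. That level is at least
              \<open>q\<close> times as long as the level of \<open>i\<close>, so its excess is at
              least \<open>e\<close>.\<close>
            case 2
            then have "j < i" using level_antimono[OF a0(1), of i j q] by (meson leD leI)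
            from less.IH[OF this] False have "q ^ (lev a0 j - 1) * (q - 1) \<le> exc a0 j + g"
              using j 2 less.prems by (metis lessThan_iff less_trans not_le)
            moreover have "e + g \<le> q ^ (lev a0 j - 1) * (q - 1)"
            proof -
              have "q ^ a0 \<le> q ^ s" using s q_pos by (intro power_increasing) auto
              with g have "g \<le> q ^ s" by simp
              also have "q ^ s * 1 \<le> q ^ s * ((q - 1) * (q - 1))"
                using q_ge_2 by (intro mult_left_mono) auto
              finally have "e + g \<le> q ^ s * ((q - 1) + (q - 1) * (q - 1))"
                unfolding e_def by (simp add: distrib_left)
              also have "(q - 1) + (q - 1) * (q - 1) = q * (q - 1)"
                using q_ge_2 by (cases q) auto
              also have "q ^ s * (q * (q - 1)) = q ^ Suc s * (q - 1)" by simp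
              also have "\<dots> \<le> q ^ (lev a0 j - 1) * (q - 1)"
                using 2 s q_pos by (intro mult_right_mono power_increasing) auto
              finally show ?thesis .
            qed
            ultimately have "e \<le> exc a0 j" by simp
            with t have "exc a0 i < exc a0 j" by simp
            from next_le[OF this] show ?thesis
              using val_ge_mono[OF val_eq_ge[OF x(2)[of j]]] 2 s by simp
          next
            case 3
            show ?thesis by (rule val_ge_mono[OF x(3)[OF 3] vN])
          next
            \<comment> \<open>Only the lowest level can drop below value one. Either the slack
              covers the loss of \<open>q ^ a0 * f\<close>, or its coefficients are already
              divisible, or \<open>w\<close> is large enough to absorb the loss.\<close>
            case 4
            from g(2) show ?thesis
            proof (elim disjE)
              assume g': "g = q ^ a0"
              have "exc a0 i + 1 \<le> e - g" using t by simp
              then have "v + 1 \<le> int ((e - g) * f)" by (intro next_le) simp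
              also have "(e - g) * f = N - q ^ a0 * f" by (simp add: diff_mult_distrib g' fe[symmetric] mult.commute[of f])
              also have "int (N - q ^ a0 * f) = int N - int (q ^ a0 * f)" using qf by simp
              finally show ?thesis by (rule val_ge_mono[OF low[OF 4(1)]])
            next
              assume "\<forall>i<q ^ k. lev a0 i = a0 \<longrightarrow> int q dvd b i"
              with False j 4 show ?thesis by auto
            next
              assume "k + 2 \<le> w + a0"
              then have "int N * 2 \<le> int N * (int w + int a0 - int k)" by (intro mult_left_mono) auto
              then have "v + 1 \<le> int N * (int w + int a0 - int k) - int (q ^ a0 * f)"
                using vN qf by linarith
              then show ?thesis by (rule val_ge_mono[OF x(4)[OF 4(1)]])
            qed
          qed
        qed
        then show ?thesis by (rule val_ge_of_int_mult)
      qed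
    qed simp
    with int[OF x(1)] show False by simp
  qed
qed

text \<open>At a root on the first side all values are proportional to the excess. On level
  \<open>a0\<close> they are distinct and below one, while \<open>high\<close> keeps every other
  term at value one or more.\<close>

lemma dvd_lowest_level:
  fixes b :: "nat \<Rightarrow> int"
  assumes a0: "a0 \<le> k" "k + 1 \<le> w + a0" "a0 = 0 \<or> w + a0 = k + 1"
    and int: "\<And>x. x ^ (q ^ k) = of_int m \<Longrightarrow> val_ge (int N) (\<Sum>i<q ^ k. of_int (b i) * elt a0 i x)"
    and high: "\<And>i. i < q ^ k \<Longrightarrow> a0 < lev a0 i \<Longrightarrow> int q dvd b i \<or> q ^ a0 \<le> exc a0 i"
  shows "i < q ^ k \<Longrightarrow> lev a0 i = a0 \<Longrightarrow> int q dvd b i"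
proof (induction i rule: less_induct)
  case (less i)
  show ?case
  proof (rule ccontr)
    assume bad: "\<not> int q dvd b i"
    obtain x f where x: "x ^ (q ^ k) = of_int m" "f > 0" "int N \<le> f * int (q ^ a0)"
      "f * (int (q ^ a0) - 1) < int N" "\<And>i. val_eq (int (exc a0 i) * f) (elt a0 i x)"
      using elt_val_first[OF a0] by metis
    define v where "v = int (exc a0 i) * f"
    have "int (exc a0 i) \<le> int (q ^ a0) - 1"
      using excess_lt[OF a0(1) less.prems(1)] unfolding less.prems(2) by linarith
    then have "v \<le> f * (int (q ^ a0) - 1)"
      unfolding v_def using x(2) by (simp add: mult.commute)
    then have vN: "v + 1 \<le> int N" using x(4) by simp
    have next_le: "v + 1 \<le> int (exc a0 j) * f" if "exc a0 i < exc a0 j" for j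
    proof -
      have "(int (exc a0 i) + 1) * f \<le> int (exc a0 j) * f" using that x(2) by (intro mult_right_mono) auto
      then show ?thesis using x(2) by (simp add: v_def distrib_right)
    qed
    have "\<not> val_ge (int N) (\<Sum>j<q ^ k. of_int (b j) * elt a0 j x)"
    proof (rule val_eq_sum_not_ge[where i = i and v = v])
      show "val_eq v (of_int (b i) * elt a0 i x)"
        unfolding v_def using bad x(5)[of i] by (rule val_eq_not_dvd_mult)
      show "v < int N" using vN by simp
      show "i \<in> {..<q ^ k}" using less.prems by simp
      fix j assume j: "j \<in> {..<q ^ k}" "j \<noteq> i"
      show "val_ge (v + 1) (of_int (b j) * elt a0 j x)"
      proof (cases "int q dvd b j")
        case True
        have "val_ge 0 (elt a0 j x)" using val_ge_mono[OF val_eq_ge[OF x(5)]] x(2) by simp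
        then show ?thesis using val_ge_mono[OF val_ge_dvd_mult[OF True] vN] by simp
      next
        case False
        have "v + 1 \<le> int (exc a0 j) * f"
        proof (cases "lev a0 j = a0")
          case True
          with less.prems have eq: "lev a0 i = lev a0 j" by simp
          have "i < j" using less.IH[of j] j True False by fastforce
          then show ?thesis using excess_less_iff[OF a0(1) _ _ eq] j less.prems by (intro next_le) auto
        next
          case False
          then have "a0 < lev a0 j" using level_props(1)[OF a0(1), of q j] by simp
          with high[of j] j \<open>\<not> int q dvd b j\<close> have "q ^ a0 \<le> exc a0 j" by auto
          then have "f * int (q ^ a0) \<le> f * int (exc a0 j)" using x(2) by (intro mult_left_mono) (auto simp only: of_nat_le_iff)
          then show ?thesis using vN x(3) by (simp add: mult.commute)
        qed
        then show ?thesis by (intro val_ge_of_int_mult val_ge_mono[OF val_eq_ge[OF x(5)]])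
      qed
    qed simp
    with int[OF x(1)] show False by simp
  qed
qed

text \<open>For \<open>q = 2\<close> the two lowest levels share a side whose residue field has four elements:
  \<open>\<omega> = (x ^ (2 ^ a0) + c ^ (2 ^ a0)) / 2\<close> and \<open>\<omega> - c ^ (2 ^ a0)\<close> are units there.\<close>

lemma omega_unit:
  assumes \<omega>: "val_eq 0 \<omega>" "val_eq 0 (\<omega> - of_int d)" and q: "q = 2" and d: "odd d"
    and ab: "odd a \<or> odd b"
  shows "val_eq 0 (of_int a * \<omega> + of_int b)"
proof -
  have odd_unit: "val_eq 0 (of_int z)" if "odd z" for z
    using val_eq_not_dvd[of z] that q by simp
  have even_ge: "val_ge (int N) (of_int z)" if "even z" for z
    using val_ge_dvd[of z] that q by simp
  have N: "0 < int N" using N_pos by simp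
  consider "odd a" "even b" | "even a" "odd b" | "odd a" "odd b" using ab by blast
  then show ?thesis
  proof cases
    case 1
    have "val_eq 0 (of_int a * \<omega>)" using val_eq_mult[OF odd_unit[OF 1(1)] \<omega>(1)] by simp
    from val_eq_add[OF this even_ge[OF 1(2)] N] show ?thesis .
  next
    case 2
    have "val_ge (int N) (of_int a * \<omega>)"
      using val_ge_mult[OF even_ge[OF 2(1)] val_eq_ge[OF \<omega>(1)]] by simp
    from val_eq_add[OF odd_unit[OF 2(2)] this N] show ?thesis by (simp add: add.commute)
  next
    case 3
    have "val_eq 0 (of_int a * (\<omega> - of_int d))" using val_eq_mult[OF odd_unit[OF 3(1)] \<omega>(2)] by simp
    from val_eq_add[OF this even_ge[of "a * d + b"] N] show ?thesis
      using 3 d by (simp add: algebra_simps)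
  qed
qed

lemma dvd_two_lowest_levels:
  fixes b :: "nat \<Rightarrow> int"
  assumes q: "q = 2" and a0: "a0 < k" "w + a0 = k + 1"
    and int: "\<And>x. x ^ (q ^ k) = of_int m \<Longrightarrow> val_ge (int N) (\<Sum>i<q ^ k. of_int (b i) * elt a0 i x)"
    and high: "\<And>i. i < q ^ k \<Longrightarrow> Suc a0 < lev a0 i \<Longrightarrow> int q dvd b i \<or> q ^ a0 \<le> exc a0 i"
    and i: "i < q ^ k" "lev a0 i \<le> Suc a0"
  shows "int q dvd b i"
proof (rule ccontr)
  assume bad: "\<not> int q dvd b i"
  have a0': "a0 \<le> k" "k + 1 \<le> w + a0" "a0 = 0 \<or> w + a0 = k + 1" using a0 by auto
  \<comment> \<open>Take the least excess of an offending coefficient. Exactly two indices on the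
    two levels share it, and every remaining term has larger value.\<close>
  define P where "P t \<longleftrightarrow> (\<exists>i<q ^ k. lev a0 i \<le> Suc a0 \<and> exc a0 i = t \<and> \<not> int q dvd b i)" for t
  define t where "t = (LEAST t. P t)"
  have "P (exc a0 i)" using bad i by (auto simp: P_def)
  then have Pt: "P t" and least: "\<And>u. P u \<Longrightarrow> t \<le> u" unfolding t_def by (auto intro: LeastI Least_le)
  obtain i' where i': "i' < q ^ k" "lev a0 i' \<le> Suc a0" "exc a0 i' = t" "\<not> int q dvd b i'"
    using Pt unfolding P_def by blast
  have t: "t < q ^ a0"
  proof (cases "lev a0 i' = a0")
    case True
    then show ?thesis using excess_lt[OF a0'(1) i'(1)] i'(3) by simp
  next
    case False
    then have "lev a0 i' = Suc a0" using i'(2) level_props(1)[OF a0'(1), of q i'] by simp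
    then show ?thesis using excess_lt'[OF a0'(1), of q i'] i'(3) q by simp
  qed
  define i1 i2 where "i1 = q ^ k - q ^ a0 + t" and "i2 = q ^ k - q ^ Suc a0 + t"
  have lk: "q ^ Suc a0 \<le> q ^ k" using a0 q_pos by (intro power_increasing) auto
  have i1: "i1 < q ^ k" "lev a0 i1 = a0" "exc a0 i1 = t"
    using level_index[of a0 a0 k q t] a0 t lk q by (auto simp: i1_def)
  have i2: "i2 < q ^ k" "lev a0 i2 = Suc a0" "exc a0 i2 = t"
    using level_index[of a0 "Suc a0" k q t] a0 t lk q by (auto simp: i2_def)
  have i_cases: "j = i1 \<or> j = i2" if "j < q ^ k" "lev a0 j \<le> Suc a0" "exc a0 j = t" for j
  proof -
    have eqI: "j = l" if l: "l < q ^ k" "lev a0 j = lev a0 l" "exc a0 l = t" for l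
      using excess_less_iff[OF a0'(1) \<open>j < q ^ k\<close> l(1,2)] excess_less_iff[OF a0'(1) l(1) \<open>j < q ^ k\<close> l(2)[symmetric]]
        l(3) \<open>exc a0 j = t\<close> by linarith
    have "lev a0 j = a0 \<or> lev a0 j = Suc a0"
      using that(2) level_props(1)[OF a0'(1), of q j] by linarith
    then show ?thesis using eqI[of i1] eqI[of i2] i1 i2 by metis
  qed
  obtain x f where x: "x ^ (q ^ k) = of_int m" "f > 0" "int N \<le> f * int (q ^ a0)"
    "f * (int (q ^ a0) - 1) < int N" "val_eq f (x - of_int c)"
    "\<And>a. a0 \<le> a \<Longrightarrow> a \<le> k \<Longrightarrow>
      val_eq (int N * (int w + int a - int k)) (x ^ (q ^ a) - of_int c ^ (q ^ a))"
    "\<And>a. a0 \<le> a \<Longrightarrow> a \<le> k \<Longrightarrow> val_eq 0 (cofactor q k a (of_int c) x / of_nat q ^ (k - a))"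
    "\<And>i. val_eq (int (exc a0 i) * f) (elt a0 i x)"
    using elt_val_first[OF a0'] by metis
  define U where "U = cofactor q k (Suc a0) (of_int c) x / of_nat q ^ (k - Suc a0)"
  define Y C where "Y = x ^ (q ^ a0)" and "C = c ^ (q ^ a0)"
  define \<omega> where "\<omega> = (Y + of_int C) / 2"
  have YC: "val_eq (int N) (Y - of_int C)"
    using x(6)[of a0] a0 by (simp add: Y_def C_def flip: of_nat_add)
  have U: "val_eq 0 U" using x(7)[of "Suc a0"] a0 by (simp add: U_def)
  \<comment> \<open>Factoring \<open>Y ^ 2 - C ^ 2\<close> shows that the cofactors of the two
    levels differ by \<open>Y + C\<close>, so after normalisation the two basis elements differ by
    the factor \<open>\<omega>\<close>.\<close>
  have "(Y - of_int C) * cofactor q k a0 (of_int c) x =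
      (Y - of_int C) * ((Y + of_int C) * cofactor q k (Suc a0) (of_int c) x)"
  proof -
    have "x ^ (q ^ Suc a0) = Y ^ 2" "of_int c ^ (q ^ Suc a0) = (of_int C :: complex) ^ 2"
      by (simp_all add: Y_def C_def q mult.commute flip: power_mult)
    then have "(Y - of_int C) * (Y + of_int C) = x ^ (q ^ Suc a0) - of_int c ^ (q ^ Suc a0)"
      by (simp add: power2_eq_square algebra_simps)
    then show ?thesis
      using cofactor_mult[of a0 k x q "of_int c"] cofactor_mult[of "Suc a0" k x q "of_int c"] a0
      by (simp add: Y_def C_def flip: mult.assoc)
  qed
  then have "cofactor q k a0 (of_int c) x = (Y + of_int C) * cofactor q k (Suc a0) (of_int c) x"
    using val_eq_nonzero[OF YC] by simp
  moreover have "k - a0 = Suc (k - Suc a0)" using a0 by simp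
  ultimately have U\<omega>: "cofactor q k a0 (of_int c) x / of_nat q ^ (k - a0) = U * \<omega>"
    using q by (simp add: U_def \<omega>_def mult_ac)
  have "val_eq 0 (U * \<omega> / U)" using val_eq_divide[OF x(7)[of a0] U] a0 by (simp add: U\<omega>)
  then have \<omega>: "val_eq 0 \<omega>" using val_eq_nonzero[OF U] by simp
  have "\<omega> - of_int C = (Y - of_int C) / of_nat q" by (simp add: \<omega>_def q field_simps)
  then have \<omega>': "val_eq 0 (\<omega> - of_int C)" using val_eq_divide[OF YC val_eq_prime] by simp
  have oddC: "odd C" using c_unit q by (simp add: C_def)
  have elt1: "elt a0 i1 x = (x - of_int c) ^ t * (U * \<omega>)" and elt2: "elt a0 i2 x = (x - of_int c) ^ t * U"
    unfolding basis_elt_def i1 i2 U\<omega>[symmetric] by (simp_all add: U_def)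
  have "odd (b i1) \<or> odd (b i2)" using i_cases[OF i'(1-3)] i'(4) q by auto
  from omega_unit[OF \<omega> \<omega>' q oddC this]
  have "val_eq (int t * f + (0 + 0)) ((x - of_int c) ^ t * (U * (of_int (b i1) * \<omega> + of_int (b i2))))"
    by (intro val_eq_mult val_eq_power x U)
  then have pair: "val_eq (int t * f) (of_int (b i1) * elt a0 i1 x + of_int (b i2) * elt a0 i2 x)"
    by (simp add: elt1 elt2 algebra_simps)
  have "int t \<le> int (q ^ a0) - 1" using t by linarith
  then have "int t * f \<le> f * (int (q ^ a0) - 1)" using x(2) by (simp add: mult.commute)
  then have tN: "int t * f + 1 \<le> int N" using x(4) by simp
  have rest: "val_ge (int t * f + 1) (of_int (b j) * elt a0 j x)" if j: "j < q ^ k" "j \<noteq> i1" "j \<noteq> i2" for j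
  proof (cases "int q dvd b j")
    case True
    have "val_ge 0 (elt a0 j x)" using val_ge_mono[OF val_eq_ge[OF x(8)]] x(2) by simp
    then show ?thesis using val_ge_mono[OF val_ge_dvd_mult[OF True] tN] by simp
  next
    case False
    have "int t * f + 1 \<le> int (exc a0 j) * f"
    proof (cases "lev a0 j \<le> Suc a0")
      case True
      with False j have "P (exc a0 j)" by (auto simp: P_def)
      moreover have "exc a0 j \<noteq> t" using i_cases[OF j(1) True] j by blast
      ultimately have "t < exc a0 j" using least by fastforce
      then have "(int t + 1) * f \<le> int (exc a0 j) * f" using x(2) by (intro mult_right_mono) auto
      then show ?thesis using x(2) by (simp add: distrib_right)
    next
      case False
      with high[of j] j \<open>\<not> int q dvd b j\<close> have "q ^ a0 \<le> exc a0 j" by auto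
      then have "f * int (q ^ a0) \<le> f * int (exc a0 j)" using x(2) by (intro mult_left_mono) (auto simp only: of_nat_le_iff)
      then show ?thesis using tN x(3) by (simp add: mult.commute)
    qed
    then show ?thesis by (intro val_ge_of_int_mult val_ge_mono[OF val_eq_ge[OF x(8)]])
  qed
  define F where "F j = of_int (b j) * elt a0 j x" for j
  have ne: "i1 \<noteq> i2" using i1 i2 by auto
  have "sum F {..<q ^ k} = (F i1 + F i2) + sum F ({..<q ^ k} - {i1, i2})"
    using sum.subset_diff[of "{i1, i2}" "{..<q ^ k}" F] i1 i2 ne by (simp add: add.commute)
  moreover have "val_ge (int t * f + 1) (sum F ({..<q ^ k} - {i1, i2}))"
    unfolding F_def by (intro val_ge_sum rest) auto
  ultimately have "val_eq (int t * f) (sum F {..<q ^ k})"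
    using val_eq_add[OF pair] by (simp add: F_def)
  from val_eq_imp_le[OF this, of "int N"] int[OF x(1)] tN show False by (simp add: F_def)
qed

text \<open>The first pass uses slack \<open>q ^ a0\<close>. For \<open>q > 2\<close> it leaves only
  coefficients with excess at least \<open>q ^ a0\<close>, since
  \<open>q ^ (a - 1) * (q - 1) - q ^ a0 \<ge> q ^ a0\<close> for \<open>a > a0\<close>; for
  \<open>q = 2\<close> this is lost at \<open>a = a0 + 1\<close>, whence the joint treatment of two
  levels. If \<open>q = 2\<close> and \<open>w + a0 > k + 1\<close>, slack \<open>0\<close> works at
  once. With the lowest level settled, a last pass with slack \<open>0\<close> covers all higher
  levels.\<close>

theorem basis_saturated:
  fixes b :: "nat \<Rightarrow> int"
  assumes a0: "a0 \<le> k" "k + 1 \<le> w + a0" "a0 = 0 \<or> w + a0 = k + 1"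
    and int: "\<And>x. x ^ (q ^ k) = of_int m \<Longrightarrow> val_ge (int N) (\<Sum>i<q ^ k. of_int (b i) * elt a0 i x)"
    and i: "i < q ^ k"
  shows "int q dvd b i"
proof -
  have pow: "q ^ a0 * u \<le> q ^ (lev a0 j - 1) * u" if "a0 < lev a0 j" for j u
    using that q_pos by (intro mult_right_mono power_increasing) auto
  have low: "\<forall>i<q ^ k. lev a0 i = a0 \<longrightarrow> int q dvd b i"
  proof (cases "q = 2 \<and> w + a0 \<noteq> k + 1")
    case True
    then have "k + 2 \<le> w + a0" using a0 by simp
    with dvd_high_levels[OF a0(1,2) int, of 0] excess_lt'[OF a0(1)]
    have "int q dvd b j" if "j < q ^ k" "a0 < lev a0 j" for j using that by simp
    then show ?thesis using dvd_lowest_level[OF a0 int] by blast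
  next
    case False
    have slack: "int q dvd b j \<or> q ^ (lev a0 j - 1) * (q - 1) \<le> exc a0 j + q ^ a0"
      if "j < q ^ k" "a0 < lev a0 j" for j
      using dvd_high_levels[OF a0(1,2) int, of "q ^ a0" j] that by (meson not_le order_refl)
    show ?thesis
    proof (cases "q = 2")
      case q2: True
      show ?thesis
      proof (cases "a0 = k")
        case True
        then have "\<not> a0 < lev a0 j" for j using level_props(3)[OF a0(1), of q j] by simp
        then show ?thesis using dvd_lowest_level[OF a0 int] by blast
      next
        case neq: False
        have "int q dvd b j \<or> q ^ a0 \<le> exc a0 j" if j: "j < q ^ k" "Suc a0 < lev a0 j" for j
        proof -
          have "q ^ Suc a0 \<le> q ^ (lev a0 j - 1)" using j q_pos by (intro power_increasing) auto
          then have "q ^ a0 + q ^ a0 \<le> q ^ (lev a0 j - 1)" by (simp add: q2)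
          with slack[of j] j show ?thesis by (auto simp: q2)
        qed
        from dvd_two_lowest_levels[OF q2 _ _ int this] a0 neq False q2 show ?thesis by auto
      qed
    next
      case q3: False
      have "int q dvd b j \<or> q ^ a0 \<le> exc a0 j" if j: "j < q ^ k" "a0 < lev a0 j" for j
      proof -
        have "q ^ a0 * 2 \<le> q ^ a0 * (q - 1)" using q3 q_ge_2 by (intro mult_left_mono) auto
        with pow[OF j(2), of "q - 1"] slack[OF j] show ?thesis by linarith
      qed
      then show ?thesis using dvd_lowest_level[OF a0 int] by blast
    qed
  qed
  show ?thesis
  proof (cases "lev a0 i = a0")
    case True
    then show ?thesis using low i by blast
  next
    case False
    then have "a0 < lev a0 i" using level_props(1)[OF a0(1), of q i] by simp
    then show ?thesis
      using dvd_high_levels[OF a0(1,2) int, of 0 i] low i excess_lt'[OF a0(1), of q i] by simp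
  qed
qed

end

section \<open>Integral bases and saturation\<close>

lemma algebraic_int_add [intro]: "algebraic_int x \<Longrightarrow> algebraic_int y \<Longrightarrow> algebraic_int (x + y)"
  and algebraic_int_mult [intro]: "algebraic_int x \<Longrightarrow> algebraic_int y \<Longrightarrow> algebraic_int (x * y)"
  and algebraic_int_power [intro]: "algebraic_int x \<Longrightarrow> algebraic_int (x ^ n)"
  for x y :: "'a::field_char_0"
  using unital_subring.add_mem[OF unital_subring_algebraic_int]
    unital_subring.mult_mem[OF unital_subring_algebraic_int]
    unital_subring.power_mem[OF unital_subring_algebraic_int] by auto

lemma algebraic_int_sum [intro]:
  fixes f :: "'b \<Rightarrow> 'a::field_char_0"
  shows "(\<And>i. i \<in> I \<Longrightarrow> algebraic_int (f i)) \<Longrightarrow> algebraic_int (sum f I)"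
  using unital_subring.sum_mem[OF unital_subring_algebraic_int, of I f] by auto

lemma algebraic_int_radical:
  fixes x :: "'a::field_char_0"
  assumes "x ^ n = of_int m" "n > 0"
  shows "algebraic_int x"
proof (rule algebraic_int_root)
  show "poly (monom 1 n) x = of_int m" using assms by (simp add: poly_monom)
qed (use assms in \<open>simp_all add: degree_monom_eq int_imp_algebraic_int\<close>)

section \<open>Evaluation of rational polynomials at complex numbers\<close>

abbreviation ev :: "rat poly \<Rightarrow> complex \<Rightarrow> complex" where
  "ev h x \<equiv> poly (map_poly of_rat h) x"

lemma ev_pCons [simp]: "ev (pCons a h) x = of_rat a + x * ev h x"
  by (simp add: map_poly_pCons)

lemma ev_add [simp]: "ev (f + g) x = ev f x + ev g x"
  by (induction f g rule: poly_induct2) (simp_all add: of_rat_add algebra_simps)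

lemma ev_smult [simp]: "ev (smult c f) x = of_rat c * ev f x"
  by (induction f) (simp_all add: of_rat_mult algebra_simps)

lemma ev_uminus [simp]: "ev (- f) x = - ev f x"
  using ev_smult[of "-1" f x] by (simp add: of_rat_minus)

lemma ev_diff [simp]: "ev (f - g) x = ev f x - ev g x"
  using ev_add[of f "- g" x] by simp

lemma ev_mult [simp]: "ev (f * g) x = ev f x * ev g x"
  by (induction f) (simp_all add: algebra_simps)

lemma ev_1 [simp]: "ev 1 x = 1"
  by (simp add: one_pCons)

lemma ev_power [simp]: "ev (f ^ j) x = ev f x ^ j"
  by (induction j) simp_all

lemma ev_sum [simp]: "ev (sum f I) x = (\<Sum>i\<in>I. ev (f i) x)"
  by (induction I rule: infinite_finite_induct) simp_all

lemma ev_monom [simp]: "ev (monom a j) x = of_rat a * x ^ j"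
  by (induction j) (simp_all add: monom_0 monom_Suc)

lemma ev_pcompose: "ev (pcompose f g) x = ev f (ev g x)"
  by (induction f) (simp_all add: pcompose_pCons)

lemma ev_of_int_poly: "ev (map_poly of_int f) x = poly (map_poly of_int f) x"
  by (induction f) (simp_all add: map_poly_pCons)

lemma ev_altdef:
  assumes "\<And>i. n \<le> i \<Longrightarrow> coeff h i = 0"
  shows "ev h x = (\<Sum>i<n. of_rat (coeff h i) * x ^ i)"
proof -
  have "h = (\<Sum>i<n. monom (coeff h i) i)"
    using assms by (intro poly_eqI) (simp add: coeff_sum)
  then have "ev h x = ev (\<Sum>i<n. monom (coeff h i) i) x" by simp
  then show ?thesis by simp
qed

text \<open>Maximality at \<open>q\<close> of the lattice spanned by \<open>b\<close>. It is stated
  on coefficients so that it also yields linear independence.\<close>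

definition saturated :: "nat \<Rightarrow> nat \<Rightarrow> (nat \<Rightarrow> complex) \<Rightarrow> bool" where
  "saturated q n b \<longleftrightarrow> (\<forall>a :: nat \<Rightarrow> int.
     algebraic_int ((\<Sum>i<n. of_int (a i) * b i) / of_nat q) \<longrightarrow> (\<forall>i<n. int q dvd a i))"

lemma saturated_div:
  assumes "\<forall>i<n. int q dvd a i"
  shows "(\<Sum>i<n. of_int (a i) * b i :: complex) = of_nat q * (\<Sum>i<n. of_int (a i div int q) * b i)"
  unfolding sum_distrib_left
proof (rule sum.cong[OF refl])
  fix i assume "i \<in> {..<n}"
  then have "a i = int q * (a i div int q)" using assms by simp
  then have "(of_int (a i) :: complex) = of_nat q * of_int (a i div int q)"
    by (metis of_int_mult of_int_of_nat_eq)
  then show "of_int (a i) * b i = of_nat q * (of_int (a i div int q) * b i)" by simp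
qed

text \<open>Zero is divisible by \<open>q\<close>, hence so are the coefficients of a relation, and
  dividing them by \<open>q\<close> gives another relation; a coefficient divisible by every power
  of \<open>q\<close> vanishes.\<close>

lemma saturated_independent:
  assumes q: "q \<ge> 2" and sat: "saturated q n b" and zero: "(\<Sum>i<n. of_int (a i) * b i) = 0" and "i < n"
  shows "a i = 0"
proof (rule ccontr)
  have "\<forall>i<n. int q ^ e dvd a i" if "(\<Sum>i<n. of_int (a i) * b i) = 0" for e a
    using that
  proof (induction e arbitrary: a)
    case (Suc e)
    have dvd: "\<forall>i<n. int q dvd a i" using sat Suc.prems by (simp add: saturated_def)
    have "(\<Sum>i<n. of_int (a i div int q) * b i) = 0"
      using saturated_div[OF dvd, of b] Suc.prems q by simp
    from Suc.IH[OF this] have "\<forall>i<n. int q ^ e dvd a i div int q" .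
    then show ?case using dvd by (metis dvd_mult_div_cancel mult_dvd_mono dvd_refl power_Suc)
  qed simp
  from this[OF zero, of "nat \<bar>a i\<bar>"] have "int q ^ nat \<bar>a i\<bar> dvd a i" using \<open>i < n\<close> by simp
  moreover assume "a i \<noteq> 0"
  ultimately have "int q ^ nat \<bar>a i\<bar> \<le> \<bar>a i\<bar>" using dvd_imp_le_int[of "a i" "int q ^ nat \<bar>a i\<bar>"] by simp
  moreover have "int (nat \<bar>a i\<bar>) < int (q ^ nat \<bar>a i\<bar>)"
    unfolding of_nat_less_iff using q by (intro power_gt_expt) simp
  ultimately show False by simp
qed

text \<open>The denominator \<open>D\<close> is cleared one prime factor at a time.\<close>

lemma saturated_descend:
  assumes "D > 0" and "\<And>q. prime q \<Longrightarrow> q dvd D \<Longrightarrow> saturated q n b" and "algebraic_int x"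
    and "of_nat D * x = (\<Sum>i<n. of_int (a i) * b i)"
  shows "\<exists>a. x = (\<Sum>i<n. of_int (a i) * b i)"
  using assms(1,2,4)
proof (induction D arbitrary: a rule: less_induct)
  case (less D)
  show ?case
  proof (cases "D = 1")
    case True
    then show ?thesis using less.prems(3) by auto
  next
    case False
    then obtain q where q: "prime q" "q dvd D" using prime_factor_nat by blast
    then obtain D' where D': "D = q * D'" by auto
    have q2: "q \<ge> 2" using q prime_ge_2_nat by blast
    have y: "of_nat D' * x = (\<Sum>i<n. of_int (a i) * b i) / of_nat q"
      using less.prems(3) q2 by (simp add: D' field_simps)
    have "algebraic_int (of_nat D' * x)" by (rule algebraic_int_mult[OF int_imp_algebraic_int[OF Ints_of_nat] assms(3)])
    then have dvd: "\<forall>i<n. int q dvd a i" using less.prems(2)[OF q] by (simp add: saturated_def y)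
    have "of_nat D' * x = (\<Sum>i<n. of_int (a i div int q) * b i)"
      unfolding y saturated_div[OF dvd] using q2 by simp
    moreover have "0 < D'" "D' < D" using less.prems(1) q2 by (auto simp: D')
    ultimately show ?thesis using less.IH[of D'] less.prems(2) by (simp add: D')
  qed
qed

lemma prime_valuation_exists:
  assumes q: "prime q" and N: "N > 0"
  obtains B \<pi> where "prime_valuation B q N \<pi>"
proof -
  have "inverse (of_nat q :: complex) \<notin> \<int>"
  proof
    assume "inverse (of_nat q :: complex) \<in> \<int>"
    then obtain z where "inverse (of_nat q :: complex) = of_int z" by (rule Ints_cases)
    then have "(1 :: complex) = of_int (int q * z)" using q by (simp add: field_simps prime_gt_0_nat)
    then have "int q * z = 1" by (metis of_int_1 of_int_eq_iff)
    then show False using q by (metis dvd_triv_left int_dvd_int_iff not_prime_unit of_nat_1)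
  qed
  from valuation_ring_extension[OF unital_subring_Ints _ this] obtain B where
    B: "valuation_ring B" "inverse (of_nat q :: complex) \<notin> B" by auto
  obtain \<pi> :: complex where "\<pi> ^ N = of_nat q" using nth_root_exists[OF N] by blast
  with B q N have "prime_valuation B q N \<pi>"
    by (simp add: prime_valuation_def prime_valuation_axioms_def)
  then show thesis by (rule that)
qed

lemma (in prime_valuation) val_ge_if_algebraic_int:
  assumes "algebraic_int (x / of_nat q)"
  shows "val_ge (int N) x"
proof -
  have "x / of_nat q \<in> B"
    using assms valuation_ring_axioms by (simp add: algebraic_int_iff_valuation_rings)
  then have "val_ge (int N + 0) (of_nat q * (x / of_nat q))"
    by (intro val_ge_mult val_eq_ge[OF val_eq_prime]) (simp add: val_ge_0_iff)
  then show ?thesis using q_nonzero by simp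
qed

text \<open>As \<open>q\<close> divides \<open>m\<close> exactly once, \<open>\<alpha>\<close> has
  value \<open>1 / n\<close>. The least index with a coefficient prime to \<open>q\<close> would
  then determine the value of the sum, and it would be below one.\<close>

lemma eisenstein_saturated:
  assumes q: "prime q" "int q dvd m" and m: "squarefree m" and n: "n > 0" and \<alpha>: "\<alpha> ^ n = of_int m"
  shows "saturated q n (\<lambda>i. \<alpha> ^ i)"
  unfolding saturated_def
proof (intro allI impI)
  fix a :: "nat \<Rightarrow> int" and i
  assume int: "algebraic_int ((\<Sum>i<n. of_int (a i) * \<alpha> ^ i) / of_nat q)" and i: "i < n"
  obtain B \<pi> where "prime_valuation B q n \<pi>" using prime_valuation_exists[OF q(1) n] .
  then interpret prime_valuation B q n \<pi> .
  obtain m' where m': "m = int q * m'" using q(2) by auto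
  have "\<not> int q dvd m'"
  proof
    assume "int q dvd m'"
    then have "(int q)\<^sup>2 dvd m" by (auto simp: m' power2_eq_square)
    with m have "is_unit (int q)" by (auto simp: squarefree_def)
    then show False using q(1) by simp
  qed
  from val_eq_prime_power[OF this, of 1] have "val_eq (int n * 1) (\<alpha> ^ n)" by (simp add: \<alpha> m')
  then have "val_eq 1 \<alpha>" using n by (rule val_eq_root)
  then have \<alpha>v: "val_eq (int j) (\<alpha> ^ j)" for j using val_eq_power[of 1 \<alpha> j] by simp
  show "int q dvd a i"
    using i
  proof (induction i rule: less_induct)
    case (less i)
    show ?case
    proof (rule ccontr)
      assume bad: "\<not> int q dvd a i"
      have "val_eq (int i) (\<Sum>j<n. of_int (a j) * \<alpha> ^ j)"
      proof (rule val_eq_sum[where i = i])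
        show "val_eq (int i) (of_int (a i) * \<alpha> ^ i)"
          using val_eq_mult[OF val_eq_not_dvd[OF bad] \<alpha>v] by simp
        show "i \<in> {..<n}" using less.prems by simp
        fix j assume j: "j \<in> {..<n}" "j \<noteq> i"
        show "val_ge (int i + 1) (of_int (a j) * \<alpha> ^ j)"
        proof (cases "j < i")
          case True
          have "val_ge (int n + int j) (of_int (a j) * \<alpha> ^ j)"
            using less.IH[OF True] j by (intro val_ge_mult val_ge_dvd val_eq_ge[OF \<alpha>v]) auto
          then show ?thesis by (rule val_ge_mono) (use less.prems in simp)
        next
          case False
          have "val_ge (0 + int j) (of_int (a j) * \<alpha> ^ j)"
            by (intro val_ge_mult val_ge_of_int val_eq_ge[OF \<alpha>v])
          then show ?thesis by (rule val_ge_mono) (use False j in simp)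
        qed
      qed simp
      from val_eq_imp_le[OF this val_ge_if_algebraic_int[OF int]] less.prems show False by simp
    qed
  qed
qed

section \<open>Pure fields\<close>

lemma common_denominator:
  fixes f :: "nat \<Rightarrow> rat"
  shows "\<exists>D>0. \<forall>i<n. \<exists>z :: int. of_nat D * f i = of_int z"
proof (induction n)
  case (Suc n)
  then obtain D where D: "D > 0" "\<And>i. i < n \<Longrightarrow> \<exists>z :: int. of_nat D * f i = of_int z" by blast
  obtain a b where ab: "f n = of_int a / of_int b" "b > 0" by (metis quotient_of_div quotient_of_denom_pos surj_pair)
  define d where "d = nat b"
  have d: "d > 0" "(of_int b :: rat) = of_nat d" using ab by (auto simp: d_def)
  have "\<exists>z :: int. of_nat (D * d) * f i = of_int z" if i: "i < Suc n" for i
  proof (cases "i = n")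
    case True
    have "of_nat (D * d) * f n = of_int (int D * a)" using d by (simp add: ab d(2))
    then show ?thesis using True by blast
  next
    case False
    with i have "i < n" by simp
    then obtain z where "of_nat D * f i = (of_int z :: rat)" using D(2) by blast
    then have "of_nat (D * d) * f i = of_int (int d * z)" by (simp add: mult_ac)
    then show ?thesis by blast
  qed
  then show ?case using D d by (intro exI[of _ "D * d"]) auto
qed (auto intro: exI[of _ 1])

locale pure_field =
  fixes n :: nat and m :: int
  assumes n_pos: "n > 0" and squarefree_m: "squarefree m" and m_ne: "m \<noteq> 1" "m \<noteq> - 1"
begin

lemma m_nonzero: "m \<noteq> 0"
  using squarefree_m by auto

lemma prime_dvd_m: obtains q where "prime q" "int q dvd m"
proof -
  have "nat \<bar>m\<bar> \<noteq> 1" using m_ne by linarith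
  then obtain q where "prime q" "q dvd nat \<bar>m\<bar>" using prime_factor_nat by blast
  then show thesis using that by (metis dvd_abs_iff int_dvd_int_iff abs_ge_zero int_nat_eq)
qed

definition min_poly :: "rat poly" where
  "min_poly = monom 1 n - [:of_int m:]"

lemma ev_min_poly: "ev min_poly x = x ^ n - of_int m"
  by (simp add: min_poly_def)

lemma degree_min_poly: "degree min_poly = n"
proof -
  have "degree (- [:of_int m :: rat:]) < degree (monom (1 :: rat) n)" using n_pos by (simp add: degree_monom_eq)
  then have "degree (monom (1 :: rat) n + (- [:of_int m:])) = degree (monom (1 :: rat) n)"
    by (rule degree_add_eq_left)
  then show ?thesis unfolding min_poly_def diff_conv_add_uminus by (simp add: degree_monom_eq)
qed

lemma min_poly_nonzero: "min_poly \<noteq> 0"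
  using degree_min_poly n_pos by auto

lemma ev_mod: "x ^ n = of_int m \<Longrightarrow> ev h x = ev (h mod min_poly) x"
proof -
  assume x: "x ^ n = of_int m"
  have "ev h x = ev (h div min_poly * min_poly + h mod min_poly) x" by (simp only: div_mult_mod_eq)
  then show ?thesis unfolding ev_add ev_mult ev_min_poly using x by simp
qed

lemma ev_reduce:
  assumes "x ^ n = of_int m"
  shows "ev h x = (\<Sum>i<n. of_rat (coeff (h mod min_poly) i) * x ^ i)"
proof -
  have "coeff (h mod min_poly) i = 0" if "n \<le> i" for i
    using degree_mod_less[OF min_poly_nonzero, of h] that
    by (auto simp: degree_min_poly intro: coeff_eq_0)
  then show ?thesis using ev_mod[OF assms] ev_altdef by metis
qed

text \<open>The powers of a root are independent by Eisenstein saturation at a prime factor of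
  \<open>m\<close>. So \<open>h\<close> vanishes at \<open>x\<close> only if it is a multiple of
  \<open>X ^ n - m\<close>, and then it vanishes at every root.\<close>

lemma ev_conjugate_zero:
  assumes "x ^ n = of_int m" "y ^ n = of_int m" "ev h x = 0"
  shows "ev h y = 0"
proof -
  define f where "f = coeff (h mod min_poly)"
  obtain q where q: "prime q" "int q dvd m" by (rule prime_dvd_m)
  obtain D where D: "D > 0" "\<forall>i<n. \<exists>z :: int. of_nat D * f i = of_int z"
    using common_denominator[of n f] by blast
  then obtain z :: "nat \<Rightarrow> int" where z: "\<And>i. i < n \<Longrightarrow> of_nat D * f i = of_int (z i)" by metis
  have zf: "of_int (z i) = (of_nat D * of_rat (f i) :: complex)" if "i < n" for i
    using z[OF that] by (metis of_rat_mult of_rat_of_int_eq of_rat_of_nat_eq)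
  have "(\<Sum>i<n. of_int (z i) * x ^ i) = of_nat D * ev h x"
    unfolding ev_reduce[OF assms(1)] sum_distrib_left
    by (rule sum.cong[OF refl]) (simp add: zf f_def)
  then have "(\<Sum>i<n. of_int (z i) * x ^ i) = 0" using assms(3) by simp
  from saturated_independent[OF prime_ge_2_nat[OF q(1)]
      eisenstein_saturated[OF q squarefree_m n_pos assms(1)] this]
  have "f i = 0" if "i < n" for i using z[OF that] D(1) that by simp
  then show ?thesis unfolding ev_reduce[OF assms(2)] by (simp flip: f_def)
qed

text \<open>A monic integral equation for \<open>ev h x\<close> is a polynomial relation for
  \<open>x\<close>, so it carries over to \<open>y\<close>.\<close>

lemma algebraic_int_conjugate:
  assumes "x ^ n = of_int m" "y ^ n = of_int m" "algebraic_int (ev h x)"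
  shows "algebraic_int (ev h y)"
proof -
  obtain p where p: "poly (map_poly of_int p) (ev h x) = 0" "lead_coeff p = 1"
    using assms(3) by (auto simp: algebraic_int_altdef_ipoly)
  then have "ev (pcompose (map_poly of_int p) h) x = 0" by (simp add: ev_pcompose ev_of_int_poly)
  from ev_conjugate_zero[OF assms(1,2) this] have "poly (map_poly of_int p) (ev h y) = 0"
    by (simp add: ev_pcompose ev_of_int_poly)
  with p(2) show ?thesis by (auto simp: algebraic_int_altdef_ipoly)
qed

text \<open>The trace of \<open>h(\<alpha>) \<alpha> ^ (n - i)\<close> is \<open>n m\<close> times the coefficient of \<open>\<alpha> ^ i\<close> in \<open>h(\<alpha>)\<close>.\<close>

lemma coeff_denominator:
  assumes \<alpha>: "\<alpha> ^ n = of_int m" and int: "algebraic_int (ev h \<alpha>)" and i: "i < n"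
  shows "of_nat n * of_int m * coeff (h mod min_poly) i \<in> \<int>"
proof -
  define f where "f = coeff (h mod min_poly)"
  define \<zeta> where "\<zeta> = cis (2 * pi / real n)"
  have \<zeta>: "\<zeta> ^ n = 1" using n_pos by (simp add: \<zeta>_def DeMoivre)
  have \<zeta>_pow: "(\<zeta> ^ l) ^ n = 1" for l using \<zeta> by (metis mult.commute power_mult power_one)
  have root: "(\<alpha> * \<zeta> ^ l) ^ n = of_int m" for l using \<alpha> \<zeta>_pow by (simp add: power_mult_distrib)
  have sum_\<zeta>: "(\<Sum>l<n. (\<zeta> ^ j) ^ l) = (if n dvd j then of_nat n else 0)" for j
  proof (cases "\<zeta> ^ j = 1")
    case True
    then show ?thesis using cis_power_eq_1_imp_dvd[OF n_pos, of j] by (simp add: \<zeta>_def)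
  next
    case False
    then have "\<not> n dvd j" using \<zeta> by (auto simp: power_mult)
    then show ?thesis using geometric_sum[OF False, of n] \<zeta>_pow by simp
  qed
  have "(\<Sum>l<n. ev h (\<alpha> * \<zeta> ^ l) * (\<alpha> * \<zeta> ^ l) ^ (n - i)) =
      (\<Sum>l<n. \<Sum>j<n. of_rat (f j) * \<alpha> ^ (j + (n - i)) * (\<zeta> ^ (j + (n - i))) ^ l)"
    unfolding ev_reduce[OF root] sum_distrib_right f_def
    by (intro sum.cong refl) (simp add: power_mult_distrib power_add mult_ac flip: power_mult)
  also have "\<dots> = (\<Sum>j<n. of_rat (f j) * \<alpha> ^ (j + (n - i)) * (\<Sum>l<n. (\<zeta> ^ (j + (n - i))) ^ l))"
    by (subst sum.swap) (simp add: sum_distrib_left)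
  also have "\<dots> = (\<Sum>j<n. if j = i then of_rat (f j) * \<alpha> ^ n * of_nat n else 0)"
  proof (rule sum.cong[OF refl])
    fix j assume j: "j \<in> {..<n}"
    have "n dvd j + (n - i) \<longleftrightarrow> j = i"
    proof
      assume "n dvd j + (n - i)"
      then obtain u where u: "j + (n - i) = n * u" by auto
      have "0 < n * u" "n * u < n * 2" unfolding u[symmetric] using i j by auto
      then have "u = 1" by auto
      then show "j = i" using u i by simp
    qed (use i in auto)
    then show "of_rat (f j) * \<alpha> ^ (j + (n - i)) * (\<Sum>l<n. (\<zeta> ^ (j + (n - i))) ^ l) =
        (if j = i then of_rat (f j) * \<alpha> ^ n * of_nat n else 0)"
      unfolding sum_\<zeta> using i by auto
  qed
  also have "\<dots> = of_rat (of_nat n * of_int m * f i)"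
    using i by (simp add: \<alpha> of_rat_mult mult_ac)
  finally have trace: "of_rat (of_nat n * of_int m * f i) =
    (\<Sum>l<n. ev h (\<alpha> * \<zeta> ^ l) * (\<alpha> * \<zeta> ^ l) ^ (n - i))" by simp
  have "algebraic_int (\<alpha> * \<zeta> ^ l)" for l by (rule algebraic_int_radical[OF root n_pos])
  then have "algebraic_int (of_rat (of_nat n * of_int m * f i) :: complex)"
    unfolding trace
    by (intro algebraic_int_sum algebraic_int_mult[OF algebraic_int_conjugate[OF \<alpha> root int]] algebraic_int_power)
  then have "(of_rat (of_nat n * of_int m * f i) :: complex) \<in> \<int>"
    by (intro rational_algebraic_int_is_int) auto
  then obtain u where "(of_rat (of_nat n * of_int m * f i) :: complex) = of_int u" by (rule Ints_cases)
  then have "of_nat n * of_int m * f i = of_int u" by (metis of_rat_eq_iff of_rat_of_int_eq)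
  then show ?thesis by (simp add: f_def)
qed

text \<open>The trace leaves the denominator \<open>n * m\<close>; every prime factor of the
  square-free \<open>m\<close> is Eisenstein, so the factor \<open>m\<close> can be cleared.\<close>

lemma degree_multiple_in_powers:
  assumes \<alpha>: "\<alpha> ^ n = of_int m" and int: "algebraic_int (ev h \<alpha>)"
  shows "\<exists>a :: nat \<Rightarrow> int. of_nat n * ev h \<alpha> = (\<Sum>i<n. of_int (a i) * \<alpha> ^ i)"
proof -
  have pos: "nat \<bar>m\<bar> > 0" using m_nonzero by simp
  have sat: "saturated q n (\<lambda>i. \<alpha> ^ i)" if "prime q" "q dvd nat \<bar>m\<bar>" for q
    using that by (intro eisenstein_saturated[OF _ _ squarefree_m n_pos \<alpha>]) (auto simp: int_dvd_int_iff[symmetric])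
  have nx: "algebraic_int (of_nat n * ev h \<alpha>)"
    by (rule algebraic_int_mult[OF int_imp_algebraic_int[OF Ints_of_nat] int])
  have "\<exists>u. of_nat n * of_int m * coeff (h mod min_poly) i = of_int u" if "i < n" for i
    using coeff_denominator[OF \<alpha> int that] by (auto elim: Ints_cases)
  then obtain u where u: "\<And>i. i < n \<Longrightarrow> of_nat n * of_int m * coeff (h mod min_poly) i = of_int (u i)"
    by metis
  have m: "(of_nat (nat \<bar>m\<bar>) :: complex) = of_int (sgn m) * of_int m"
  proof -
    have "int (nat \<bar>m\<bar>) = sgn m * m" by (auto simp: abs_if sgn_if)
    then show ?thesis by (metis of_int_mult of_int_of_nat_eq)
  qed
  have "of_nat (nat \<bar>m\<bar>) * (of_nat n * ev h \<alpha>) = (\<Sum>i<n. of_int (sgn m * u i) * \<alpha> ^ i)"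
    unfolding ev_reduce[OF \<alpha>] sum_distrib_left
  proof (rule sum.cong[OF refl])
    fix i assume "i \<in> {..<n}"
    then have "(of_nat n * of_int m * of_rat (coeff (h mod min_poly) i) :: complex) = of_int (u i)"
      using u[of i] by (metis lessThan_iff of_rat_mult of_rat_of_int_eq of_rat_of_nat_eq)
    then show "of_nat (nat \<bar>m\<bar>) * (of_nat n * (of_rat (coeff (h mod min_poly) i) * \<alpha> ^ i)) =
        of_int (sgn m * u i) * \<alpha> ^ i"
      unfolding m by (simp add: mult_ac)
  qed
  from saturated_descend[OF pos sat nx this] show ?thesis .
qed

text \<open>The lattice contains the powers of \<open>\<alpha>\<close>, hence \<open>n\<close> times
  every integer of the field; since \<open>n\<close> is a power of \<open>p\<close>, saturation at
  \<open>p\<close> clears this denominator.\<close>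

lemma integral_basis_criterion:
  assumes \<alpha>: "\<alpha> ^ n = of_int m" and n: "n = p ^ k" and p: "prime p"
    and sat: "saturated p n (\<lambda>i. ev (h i) \<alpha>)"
    and int: "\<And>i. i < n \<Longrightarrow> algebraic_int (ev (h i) \<alpha>)"
    and span: "\<And>j. j < n \<Longrightarrow> \<exists>a :: nat \<Rightarrow> int. \<alpha> ^ j = (\<Sum>i<n. of_int (a i) * ev (h i) \<alpha>)"
  shows "is_integral_basis \<alpha> n (\<lambda>i. ev (h i) \<alpha>)"
  unfolding is_integral_basis_def
proof (intro conjI allI impI equalityI subsetI)
  fix x assume "x \<in> ring_of_integers \<alpha>"
  then obtain g where x: "x = ev g \<alpha>" "algebraic_int x"
    by (auto simp: ring_of_integers_def gen_field_def)
  obtain a :: "nat \<Rightarrow> int" where a: "of_nat n * x = (\<Sum>j<n. of_int (a j) * \<alpha> ^ j)"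
    using degree_multiple_in_powers[OF \<alpha>, of g] x by blast
  obtain c :: "nat \<Rightarrow> nat \<Rightarrow> int" where c: "\<And>j. j < n \<Longrightarrow> \<alpha> ^ j = (\<Sum>i<n. of_int (c j i) * ev (h i) \<alpha>)"
    using span by metis
  have "of_nat n * x = (\<Sum>j<n. \<Sum>i<n. of_int (a j) * (of_int (c j i) * ev (h i) \<alpha>))"
    unfolding a sum_distrib_left[symmetric] by (intro sum.cong refl) (simp flip: c)
  also have "\<dots> = (\<Sum>i<n. of_int (\<Sum>j<n. a j * c j i) * ev (h i) \<alpha>)"
    by (subst sum.swap) (simp add: sum_distrib_right mult.assoc)
  finally have nx: "of_nat (p ^ k) * x = (\<Sum>i<n. of_int (\<Sum>j<n. a j * c j i) * ev (h i) \<alpha>)"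
    by (simp add: n)
  have "\<exists>a. x = (\<Sum>i<n. of_int (a i) * ev (h i) \<alpha>)"
  proof (rule saturated_descend[OF _ _ x(2) nx])
    show "0 < p ^ k" using n n_pos by simp
    show "saturated q n (\<lambda>i. ev (h i) \<alpha>)" if "prime q" "q dvd p ^ k" for q
      using sat that p by (metis prime_dvd_power primes_dvd_imp_eq)
  qed
  then show "x \<in> {\<Sum>i<n. of_int (c i) * ev (h i) \<alpha> | c :: nat \<Rightarrow> int. True}" by blast
next
  fix x assume "x \<in> {\<Sum>i<n. of_int (c i) * ev (h i) \<alpha> | c :: nat \<Rightarrow> int. True}"
  then obtain c :: "nat \<Rightarrow> int" where x: "x = (\<Sum>i<n. of_int (c i) * ev (h i) \<alpha>)" by blast
  have "x = ev (\<Sum>i<n. smult (of_int (c i)) (h i)) \<alpha>" by (simp add: x)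
  moreover have "algebraic_int x"
    unfolding x using int by (intro algebraic_int_sum algebraic_int_mult[OF int_imp_algebraic_int[OF Ints_of_int]]) simp
  ultimately show "x \<in> ring_of_integers \<alpha>" unfolding ring_of_integers_def gen_field_def by blast
next
  fix c :: "nat \<Rightarrow> int" and i
  assume "(\<Sum>i<n. of_int (c i) * ev (h i) \<alpha>) = 0" "i < n"
  then show "c i = 0" by (rule saturated_independent[OF prime_ge_2_nat[OF p] sat])
qed

end

section \<open>The explicit integral basis\<close>

lemma cofactor_top: "cofactor p k k c x = 1"
  by (simp add: cofactor_def)

text \<open>With \<open>Z\<close> the normalised cofactor of level \<open>a + 1\<close> and \<open>E = x ^ (p ^ a) - c ^ (p ^ a)\<close>, the normalised cofactor
  of level \<open>a\<close> is \<open>W\<close> plus an integral element, and \<open>W = Z E ^ (p - 1) / p\<close> is a root of a monic quadratic.\<close>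

lemma cofactor_integral:
  fixes x :: complex
  assumes p: "prime p" and x: "x ^ (p ^ k) = of_int m" and ne: "m \<noteq> c ^ (p ^ k)"
    and dvd: "int p ^ (k + 1 - a0) dvd m - c ^ (p ^ k)" and a: "a0 \<le> a" "a \<le> k"
  shows "algebraic_int (cofactor p k a (of_int c) x / of_nat p ^ (k - a))"
  using \<open>a \<le> k\<close>
proof (induction rule: inc_induct)
  case base
  show ?case by (simp add: cofactor_top)
next
  case (step a')
  interpret A: unital_subring "{x :: complex. algebraic_int x}" by (rule unital_subring_algebraic_int)
  define y where "y = x ^ (p ^ a')"
  define C :: complex where "C = of_int c ^ (p ^ a')"
  define E where "E = y - C"
  define Z where "Z = cofactor p k (Suc a') (of_int c) x / of_nat p ^ (k - Suc a')"
  have p0: "(of_nat p :: complex) \<noteq> 0" and p2: "p \<ge> 2" using p prime_ge_2_nat by auto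
  have Cint: "algebraic_int C" by (auto simp: C_def int_imp_algebraic_int)
  have "algebraic_int x" by (rule algebraic_int_radical[OF x]) (use p2 in simp)
  then have Eint: "algebraic_int E" using A.diff_mem[of y C] Cint by (auto simp: E_def y_def)
  obtain h where h: "algebraic_int h" "y ^ p - C ^ p = E ^ p + of_nat p * E * (C ^ (p - 1) + E * h)"
    using A.prime_power_diff[OF p, of y C] Eint Cint by (auto simp: E_def)
  define H where "H = C ^ (p - 1) + E * h"
  have Hint: "algebraic_int H" unfolding H_def using Cint Eint h(1) by auto
  have Zint: "algebraic_int Z" using step.IH by (simp add: Z_def)
  have yp: "x ^ (p ^ Suc a') = y ^ p" "of_int c ^ (p ^ Suc a') = C ^ p"
    by (simp_all add: y_def C_def mult.commute flip: power_mult)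
  define D where "D = m - c ^ (p ^ k)"
  have D0: "(of_int D :: complex) \<noteq> 0" unfolding of_int_eq_0_iff using ne by (simp add: D_def)
  have xD: "x ^ (p ^ k) - of_int c ^ (p ^ k) = of_int D" by (simp add: x D_def)
  \<comment> \<open>Compared with the denominator of \<open>Z\<close>, \<open>D\<close> has two
    factors \<open>p\<close> to spare, by \<open>a0 \<le> a'\<close>; they cancel the
    \<open>p ^ 2\<close> in the denominator of \<open>W ^ 2\<close>.\<close>
  have "int p ^ (k - Suc a' + 2) dvd int p ^ (k + 1 - a0)"
    using a step.hyps by (intro le_imp_power_dvd) auto
  then have "int p ^ (k - Suc a' + 2) dvd D" using dvd unfolding D_def by (rule dvd_trans)
  then obtain d where "D = int p ^ (k - Suc a' + 2) * d" by auto
  then have Dd: "(of_int D :: complex) = of_nat p ^ (k - Suc a') * (of_nat p ^ 2 * of_int d)"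
    by (simp add: power_add power2_eq_square mult_ac)
  have fa: "E * cofactor p k a' (of_int c) x = of_int D"
    using cofactor_mult[of a' k x p "of_int c"] step.hyps xD by (simp add: E_def y_def C_def)
  have fS: "(E ^ p + of_nat p * E * H) * cofactor p k (Suc a') (of_int c) x = of_int D"
    using cofactor_mult[of "Suc a'" k x p "of_int c"] step.hyps xD unfolding yp by (simp add: h(2) H_def)
  have E0: "E \<noteq> 0" using fa D0 by auto
  obtain p' where p': "p = Suc (Suc p')" using p2 by (metis add_2_eq_Suc le_Suc_ex)
  have "E * cofactor p k a' (of_int c) x = E * ((E ^ (p - 1) + of_nat p * H) * cofactor p k (Suc a') (of_int c) x)"
    unfolding fa fS[symmetric] by (simp add: p' algebra_simps)
  then have co: "cofactor p k a' (of_int c) x = (E ^ (p - 1) + of_nat p * H) * cofactor p k (Suc a') (of_int c) x"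
    using E0 by simp
  define W where "W = Z * E ^ (p - 1) / of_nat p"
  have ka: "k - a' = Suc (k - Suc a')" using step.hyps by simp
  have eq: "cofactor p k a' (of_int c) x / of_nat p ^ (k - a') = W + Z * H"
    unfolding ka co W_def Z_def using p0 by (simp add: field_simps)
  have ZE: "Z * E ^ p = of_nat p ^ 2 * of_int d - of_nat p * (Z * H * E)"
  proof -
    have "Z * (E ^ p + of_nat p * E * H) = of_nat p ^ 2 * of_int d"
      using fS p0 unfolding Dd by (simp add: Z_def field_simps)
    then show ?thesis by (simp add: algebra_simps)
  qed
  \<comment> \<open>With \<open>p' = p - 2\<close>, the power \<open>E ^ (2 * p - 2)\<close> splits
    as \<open>E ^ p' * E ^ p\<close>, which lets \<open>ZE\<close> enter; its second term reproduces
    \<open>W\<close>.\<close>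
  have "W ^ 2 = Z * E ^ p' * (Z * E ^ p) / of_nat p ^ 2"
    by (simp add: W_def p' power2_eq_square mult_ac)
  also have "\<dots> = Z * E ^ p' * of_int d - Z * H * (Z * E ^ (p - 1) / of_nat p)"
  proof -
    have "Z * E ^ p' * (Z * E ^ p) / of_nat p ^ 2 =
      Z * E ^ p' * (of_nat p ^ 2 * of_int d) / of_nat p ^ 2 - Z * E ^ p' * (of_nat p * (Z * H * E)) / of_nat p ^ 2"
      unfolding ZE by (simp only: right_diff_distrib diff_divide_distrib)
    also have "Z * E ^ p' * (of_nat p ^ 2 * of_int d) / of_nat p ^ 2 = Z * E ^ p' * of_int d"
      using p0 by simp
    also have "Z * E ^ p' * (of_nat p * (Z * H * E)) / of_nat p ^ 2 = Z * H * (Z * E ^ (p - 1) / of_nat p)"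
      using p0 by (simp add: p' power2_eq_square del: of_nat_Suc)
    finally show ?thesis .
  qed
  finally have W2: "W ^ 2 = Z * E ^ p' * of_int d - Z * H * W" by (simp add: W_def)
  have "algebraic_int W"
  proof (rule algebraic_int_integral_closure[where d = 2 and b = "\<lambda>i. if i = 0 then Z * E ^ p' * of_int d else - (Z * H)"])
    show "W ^ 2 = (\<Sum>i<2. (if i = 0 then Z * E ^ p' * of_int d else - (Z * H)) * W ^ i)"
      unfolding W2 by (simp add: numeral_2_eq_2)
    show "algebraic_int (if i = 0 then Z * E ^ p' * of_int d else - (Z * H))" for i
      using Zint Eint Hint by (auto simp: int_imp_algebraic_int)
  qed
  then show ?case unfolding eq using Zint Hint by auto
qed

section \<open>Monic numerators of the basis and their integral span\<close>

definition int_coeffs :: "rat poly \<Rightarrow> bool" where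
  "int_coeffs f \<longleftrightarrow> (\<forall>i. coeff f i \<in> \<int>)"

lemma int_coeffs_mult: "int_coeffs f \<Longrightarrow> int_coeffs g \<Longrightarrow> int_coeffs (f * g)"
  unfolding int_coeffs_def coeff_mult
  by (intro allI unital_subring.sum_mem[OF unital_subring_Ints] Ints_mult) auto

lemma int_coeffs_power: "int_coeffs f \<Longrightarrow> int_coeffs (f ^ j)"
proof (induction j)
  case 0
  show ?case by (simp add: int_coeffs_def)
next
  case (Suc j)
  then show ?case by (simp add: int_coeffs_mult)
qed

lemma int_coeffs_sum: "(\<And>i. i \<in> I \<Longrightarrow> int_coeffs (f i)) \<Longrightarrow> int_coeffs (sum f I)"
  unfolding int_coeffs_def coeff_sum
  by (intro allI unital_subring.sum_mem[OF unital_subring_Ints]) auto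

lemma int_coeffs_pCons: "a \<in> \<int> \<Longrightarrow> int_coeffs f \<Longrightarrow> int_coeffs (pCons a f)"
  by (auto simp: int_coeffs_def coeff_pCons split: nat.splits)

lemma monic_triangular_span:
  fixes P :: "nat \<Rightarrow> rat poly"
  assumes P: "\<And>i. i < n \<Longrightarrow> degree (P i) = i" "\<And>i. i < n \<Longrightarrow> lead_coeff (P i) = 1"
      "\<And>i. i < n \<Longrightarrow> int_coeffs (P i)"
    and f: "int_coeffs f" "\<And>i. d \<le> i \<Longrightarrow> coeff f i = 0" and "d \<le> n"
  shows "\<exists>c :: nat \<Rightarrow> int. f = (\<Sum>i<d. smult (of_int (c i)) (P i))"
  using f \<open>d \<le> n\<close>
proof (induction d arbitrary: f)
  case 0
  then have "f = 0" by (intro poly_eqI) simp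
  then show ?case by simp
next
  case (Suc d)
  obtain z where z: "coeff f d = of_int z" using Suc.prems(1) by (auto simp: int_coeffs_def elim: Ints_cases)
  define g where "g = f - smult (of_int z) (P d)"
  have "coeff g i = 0" if "d \<le> i" for i
  proof (cases "i = d")
    case True
    then show ?thesis using P(1,2)[of d] Suc.prems(3) z by (simp add: g_def)
  next
    case False
    then show ?thesis using P(1)[of d] Suc.prems that by (simp add: g_def coeff_eq_0)
  qed
  moreover have "int_coeffs g"
    using Suc.prems(1,3) P(3)[of d] by (simp add: g_def int_coeffs_def)
  ultimately obtain c where c: "g = (\<Sum>i<d. smult (of_int (c i)) (P i))"
    using Suc.IH[of g] Suc.prems(3) by auto
  have "f = g + smult (of_int z) (P d)" by (simp add: g_def)
  also have "g = (\<Sum>i<d. smult (of_int ((c(d := z)) i)) (P i))" unfolding c by (rule sum.cong) auto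
  finally have "f = (\<Sum>i<Suc d. smult (of_int ((c(d := z)) i)) (P i))" by simp
  then show ?case by blast
qed

text \<open>The numerators are kept apart from the denominators: monic with integer coefficients and
  one of each degree below \<open>p ^ k\<close>, they span all integer polynomials of smaller
  degree, so the lattice contains the powers of \<open>\<alpha>\<close>.\<close>

definition monic_elt :: "nat \<Rightarrow> nat \<Rightarrow> nat \<Rightarrow> int \<Rightarrow> nat \<Rightarrow> rat poly" where
  "monic_elt p k a0 c i =
     [:- of_int c, 1:] ^ excess p k a0 i * cofactor p k (level p k a0 i) [:of_int c:] [:0, 1:]"

definition basis_poly :: "nat \<Rightarrow> nat \<Rightarrow> nat \<Rightarrow> int \<Rightarrow> nat \<Rightarrow> rat poly" where
  "basis_poly p k a0 c i = smult (1 / of_nat p ^ (k - level p k a0 i)) (monic_elt p k a0 c i)"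

lemma ev_cofactor: "ev (cofactor p k a f g) x = cofactor p k a (ev f x) (ev g x)"
  by (simp add: cofactor_def)

lemma ev_basis_poly: "ev (basis_poly p k a0 c i) x = basis_elt p k a0 (of_int c) i x"
  by (simp add: basis_poly_def monic_elt_def basis_elt_def ev_cofactor of_rat_divide of_rat_power of_rat_minus)

lemma int_coeffs_monic_elt: "int_coeffs (monic_elt p k a0 c i)"
proof -
  have "int_coeffs 0" by (simp add: int_coeffs_def)
  then show ?thesis unfolding monic_elt_def cofactor_def
    by (intro int_coeffs_mult int_coeffs_power int_coeffs_sum int_coeffs_pCons) auto
qed

text \<open>Degree and leading coefficient of the cofactor are read off the product identity
  \<open>cofactor_mult\<close>.\<close>

lemma monic_elt_degree:
  assumes p: "p > 0" and a0: "a0 \<le> k" and i: "i < p ^ k"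
  shows "degree (monic_elt p k a0 c i) = i" "lead_coeff (monic_elt p k a0 c i) = 1"
proof -
  define X where "X = [:0, 1 :: rat:]"
  have pow: "degree (X ^ u - [:of_int c:] ^ u) = u" "lead_coeff (X ^ u - [:of_int c:] ^ u) = 1" if "u > 0" for u
  proof -
    have X: "X ^ u = monom 1 u" by (simp add: X_def monom_altdef)
    have C: "[:of_int c:] ^ u = [:of_int c ^ u :: rat:]" by (simp add: poly_const_pow)
    have "degree (- [:of_int c ^ u :: rat:]) < degree (X ^ u)" using that by (simp add: X degree_monom_eq)
    from degree_add_eq_left[OF this] lead_coeff_add_le[OF this]
    have "degree (X ^ u + (- [:of_int c ^ u :: rat:])) = degree (X ^ u)"
      "lead_coeff (X ^ u + (- [:of_int c ^ u :: rat:])) = lead_coeff (X ^ u)"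
      by (simp_all only: add.commute[of "X ^ u"])
    then show "degree (X ^ u - [:of_int c:] ^ u) = u" "lead_coeff (X ^ u - [:of_int c:] ^ u) = 1"
      unfolding C diff_conv_add_uminus by (simp_all add: X degree_monom_eq)
  qed
  define a where "a = level p k a0 i"
  have a: "a \<le> k" using level_props(3)[OF a0] by (simp add: a_def)
  define co where "co = cofactor p k a [:of_int c :: rat:] X"
  have mult: "(X ^ (p ^ a) - [:of_int c:] ^ (p ^ a)) * co = X ^ (p ^ k) - [:of_int c:] ^ (p ^ k)"
    unfolding co_def by (rule cofactor_mult[OF a])
  have pos: "p ^ a > 0" "p ^ k > 0" using p by auto
  have lead: "lead_coeff co = 1"
    using arg_cong[OF mult, of lead_coeff] pow(2)[OF pos(1)] pow(2)[OF pos(2)] by (simp only: lead_coeff_mult mult_1_left)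
  then have nz: "co \<noteq> 0" by auto
  have "X ^ (p ^ a) - [:of_int c:] ^ (p ^ a) \<noteq> 0" using pow(2)[OF pos(1)] by auto
  then have deg: "p ^ a + degree co = p ^ k"
    using arg_cong[OF mult, of degree] pow(1)[OF pos(1)] pow(1)[OF pos(2)] nz by (simp add: degree_mult_eq)
  have e: "excess p k a0 i + (p ^ k - i) = p ^ a" using excess_add[OF a0] by (simp add: a_def)
  have m: "monic_elt p k a0 c i = [:- of_int c, 1:] ^ excess p k a0 i * co"
    by (simp add: monic_elt_def co_def X_def a_def)
  have nz': "[:- of_int c, 1 :: rat:] ^ excess p k a0 i \<noteq> 0" by simp
  have "degree (monic_elt p k a0 c i) = excess p k a0 i + degree co"
    unfolding m degree_mult_eq[OF nz' nz] by (simp add: degree_power_eq)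
  then show "degree (monic_elt p k a0 c i) = i" using e deg i by linarith
  show "lead_coeff (monic_elt p k a0 c i) = 1"
    unfolding m lead_coeff_mult lead_coeff_power lead by simp
qed

text \<open>Iterated Fermat. It makes \<open>a0 \<le> k\<close> in the final theorem.\<close>

lemma frobenius_int:
  fixes r :: int
  assumes p: "prime p"
  shows "int p dvd r - r ^ (p ^ k)"
proof -
  have base: "[z ^ p = z] (mod int p)" for z :: int
  proof (cases "int p dvd z")
    case True
    then have "int p dvd z ^ p" using p by (meson dvd_power dvd_trans prime_gt_0_nat)
    then show ?thesis using True by (simp add: cong_iff_dvd_diff)
  next
    case False
    define u where "u = nat (z mod int p)"
    have pp: "int p > 0" using p by (simp add: prime_gt_0_nat)
    have u: "int u = z mod int p" using pp by (simp add: u_def)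
    have "\<not> p dvd u" using False u pp by (metis dvd_mod_iff int_dvd_int_iff dvd_refl)
    then have "[u ^ (p - 1) = 1] (mod p)" using p by (intro fermat_theorem)
    then have "[u ^ (p - 1) * u = 1 * u] (mod p)" by (intro cong_mult cong_refl)
    then have "[u ^ p = u] (mod p)" using p by (simp add: power_eq_if prime_gt_0_nat mult.commute)
    then have "[int u ^ p = int u] (mod int p)" by (metis cong_int_iff of_nat_power)
    moreover have "[int u = z] (mod int p)" by (simp add: u)
    ultimately show ?thesis by (meson cong_pow cong_sym cong_trans)
  qed
  have "[r ^ (p ^ k) = r] (mod int p)"
  proof (induction k)
    case (Suc k)
    have "r ^ (p ^ Suc k) = (r ^ (p ^ k)) ^ p" by (simp add: mult.commute flip: power_mult)
    then show ?case using base[of "r ^ (p ^ k)"] Suc by (metis cong_trans)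
  qed simp
  then show ?thesis by (metis cong_iff_dvd_diff cong_sym)
qed

text \<open>The valuations are known at specially built roots of \<open>X ^ (p ^ k) - m\<close>, not
  at the given \<open>\<alpha>\<close>; conjugation carries integrality from \<open>\<alpha>\<close>
  to them.\<close>

lemma basis_poly_saturated:
  assumes p: "prime p" and k: "k > 0" and m: "squarefree m" "m \<noteq> 1" "m \<noteq> - 1"
    and c: "\<not> int p dvd c" and ne: "m \<noteq> c ^ (p ^ k)"
    and a0: "a0 \<le> k" "int p ^ (k + 1 - a0) dvd m - c ^ (p ^ k)"
      "a0 = 0 \<or> \<not> int p ^ (k + 2 - a0) dvd m - c ^ (p ^ k)"
    and \<alpha>: "\<alpha> ^ (p ^ k) = of_int m"
  shows "saturated p (p ^ k) (\<lambda>i. ev (basis_poly p k a0 c i) \<alpha>)"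
  unfolding saturated_def
proof (intro allI impI)
  fix b :: "nat \<Rightarrow> int" and i
  assume int: "algebraic_int ((\<Sum>i<p ^ k. of_int (b i) * ev (basis_poly p k a0 c i) \<alpha>) / of_nat p)" and i: "i < p ^ k"
  have p2: "p \<ge> 2" using p prime_ge_2_nat by blast
  interpret pure_field "p ^ k" m using m p2 by unfold_locales auto
  define N where "N = p ^ k * (p - 1)"
  have N: "N > 0" using p2 by (simp add: N_def)
  obtain B \<pi> where "prime_valuation B p N \<pi>" using prime_valuation_exists[OF p N] .
  then interpret V: prime_valuation B p N \<pi> .
  define D where "D = m - c ^ (p ^ k)"
  define w where "w = multiplicity (int p) D"
  have D0: "D \<noteq> 0" using ne by (simp add: D_def)
  have np: "\<not> is_unit (int p)" using p2 by simp
  obtain d where d: "D = int p ^ w * d" "\<not> int p dvd d"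
    using multiplicity_decompose'[OF D0 np] unfolding w_def by metis
  \<comment> \<open>The divisibility hypotheses say that \<open>a0\<close> is the maximum of
    \<open>0\<close> and \<open>k + 1 - w\<close>.\<close>
  have "k + 1 - a0 \<le> w" using a0(2) D0 np by (simp add: w_def D_def power_dvd_iff_le_multiplicity)
  then have w1: "k + 1 \<le> w + a0" by simp
  have w2: "a0 = 0 \<or> w + a0 = k + 1"
  proof (cases "a0 = 0")
    case False
    then have "\<not> k + 2 - a0 \<le> w" using a0(3) D0 np by (simp add: w_def D_def power_dvd_iff_le_multiplicity)
    then show ?thesis using w1 by linarith
  qed simp
  interpret R: binomial_roots B p N \<pi> k w m c
  proof
    show "V.val_eq (int N * int w) (of_int m - of_int c ^ (p ^ k))"
      using V.val_eq_prime_power[OF d(2), of w] unfolding d(1)[symmetric] by (simp add: D_def)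
  qed (use c in \<open>simp_all add: N_def\<close>)
  show "int p dvd b i"
  proof (rule R.basis_saturated[OF a0(1) w1 w2 _ i])
    fix x :: complex assume x: "x ^ (p ^ k) = of_int m"
    define h where "h = smult (1 / of_nat p) (\<Sum>i<p ^ k. smult (of_int (b i)) (basis_poly p k a0 c i))"
    have h: "ev h y = (\<Sum>i<p ^ k. of_int (b i) * ev (basis_poly p k a0 c i) y) / of_nat p" for y
      by (simp add: h_def of_rat_divide)
    have "algebraic_int (ev h \<alpha>)" using int by (simp add: h)
    from algebraic_int_conjugate[OF \<alpha> x this]
    have "algebraic_int ((\<Sum>i<p ^ k. of_int (b i) * basis_elt p k a0 (of_int c) i x) / of_nat p)"
      by (simp add: h ev_basis_poly)
    then show "V.val_ge (int N) (\<Sum>i<p ^ k. of_int (b i) * basis_elt p k a0 (of_int c) i x)"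
      by (rule V.val_ge_if_algebraic_int)
  qed
qed

lemma basis_poly_integral_basis:
  assumes p: "prime p" and k: "k > 0" and m: "squarefree m" "m \<noteq> 1" "m \<noteq> - 1"
    and c: "\<not> int p dvd c"
    and a0: "a0 \<le> k" "int p ^ (k + 1 - a0) dvd m - c ^ (p ^ k)"
      "a0 = 0 \<or> \<not> int p ^ (k + 2 - a0) dvd m - c ^ (p ^ k)"
    and \<alpha>: "\<alpha> ^ (p ^ k) = of_int m"
  shows "is_integral_basis \<alpha> (p ^ k) (\<lambda>i. ev (basis_poly p k a0 c i) \<alpha>)"
proof -
  have p2: "p \<ge> 2" using p prime_ge_2_nat by blast
  interpret pure_field "p ^ k" m using m p2 by unfold_locales auto
  have n2: "2 \<le> p ^ k" using p2 k self_le_power[of p k] by linarith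
  \<comment> \<open>Guarantees that the valuation \<open>w\<close> of \<open>m - c ^ (p ^ k)\<close>
    is finite.\<close>
  have ne: "m \<noteq> c ^ (p ^ k)"
  proof
    assume mc: "m = c ^ (p ^ k)"
    then have "c\<^sup>2 dvd m" using n2 by (simp add: le_imp_power_dvd)
    then have "is_unit c" using m(1) by (simp add: squarefree_def)
    then have "is_unit m" by (simp add: mc power_abs)
    then show False using m by auto
  qed
  have ppos: "p > 0" using p2 by simp
  show ?thesis
  proof (rule integral_basis_criterion[OF \<alpha> refl p])
    show "saturated p (p ^ k) (\<lambda>i. ev (basis_poly p k a0 c i) \<alpha>)"
      by (rule basis_poly_saturated[OF p k m c ne a0 \<alpha>])
  next
    fix i assume "i < p ^ k"
    have "algebraic_int \<alpha>" by (rule algebraic_int_radical[OF \<alpha> n_pos])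
    then have "algebraic_int (\<alpha> - of_int c)"
      using unital_subring.diff_mem[OF unital_subring_algebraic_int, of \<alpha> "of_int c"]
      by (simp add: int_imp_algebraic_int)
    moreover have "algebraic_int (cofactor p k (level p k a0 i) (of_int c) \<alpha> / of_nat p ^ (k - level p k a0 i))"
      by (rule cofactor_integral[OF p \<alpha> ne a0(2) level_props(1,3)[OF a0(1)]])
    ultimately show "algebraic_int (ev (basis_poly p k a0 c i) \<alpha>)"
      unfolding ev_basis_poly basis_elt_def times_divide_eq_right[symmetric] by blast
  next
    fix j assume j: "j < p ^ k"
    have "int_coeffs (monom 1 j)" by (simp add: int_coeffs_def)
    then obtain z :: "nat \<Rightarrow> int" where z: "monom 1 j = (\<Sum>i<p ^ k. smult (of_int (z i)) (monic_elt p k a0 c i))"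
      using monic_triangular_span[of "p ^ k" "monic_elt p k a0 c" "monom 1 j" "p ^ k"]
        monic_elt_degree[OF ppos a0(1)] int_coeffs_monic_elt j by auto
    have "\<alpha> ^ j = ev (monom 1 j) \<alpha>" by simp
    also have "\<dots> = (\<Sum>i<p ^ k. of_int (z i) * ev (monic_elt p k a0 c i) \<alpha>)" unfolding z by simp
    also have "\<dots> = (\<Sum>i<p ^ k. of_int (z i * int p ^ (k - level p k a0 i)) * ev (basis_poly p k a0 c i) \<alpha>)"
      using ppos by (intro sum.cong refl) (simp add: basis_poly_def of_rat_divide of_rat_power)
    finally show "\<exists>a :: nat \<Rightarrow> int. \<alpha> ^ j = (\<Sum>i<p ^ k. of_int (a i) * ev (basis_poly p k a0 c i) \<alpha>)"
      by (intro exI[of _ "\<lambda>i. z i * int p ^ (k - level p k a0 i)"])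
  qed
qed

lemma powers_integral_basis:
  assumes p: "prime p" and m: "squarefree m" "m \<noteq> 1" "m \<noteq> - 1" "int p dvd m"
    and \<alpha>: "\<alpha> ^ (p ^ k) = of_int m"
  shows "is_integral_basis \<alpha> (p ^ k) (\<lambda>i. ev (monom 1 i) \<alpha>)"
proof -
  have p2: "p \<ge> 2" using p prime_ge_2_nat by blast
  interpret pure_field "p ^ k" m using m p2 by unfold_locales auto
  show ?thesis
  proof (rule integral_basis_criterion[OF \<alpha> refl p])
    show "saturated p (p ^ k) (\<lambda>i. ev (monom 1 i) \<alpha>)"
      using eisenstein_saturated[OF p m(4,1) n_pos \<alpha>] by simp
    have "algebraic_int \<alpha>" by (rule algebraic_int_radical[OF \<alpha> n_pos])
    then show "algebraic_int (ev (monom 1 i) \<alpha>)" for i by auto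
    fix j assume "j < p ^ k"
    then have "\<alpha> ^ j = (\<Sum>i<p ^ k. of_int (if i = j then 1 else 0) * ev (monom 1 i) \<alpha>)"
      by (simp add: if_distrib[of of_int] if_distrib[of "\<lambda>a. a * _"] cong: if_cong)
    then show "\<exists>a :: nat \<Rightarrow> int. \<alpha> ^ j = (\<Sum>i<p ^ k. of_int (a i) * ev (monom 1 i) \<alpha>)"
      by (intro exI[of _ "\<lambda>i. if i = j then 1 else 0"])
  qed
qed

theorem theorem3p9:
  fixes p k :: nat
  assumes "prime p" and "k > 0"
  shows "integral_basis_periodic (p ^ k) (p ^ (k + 1))"
  unfolding integral_basis_periodic_def
proof
  fix r :: int
  show "\<exists>h :: nat \<Rightarrow> rat poly. \<forall>m :: int.
    squarefree m \<and> m \<noteq> 1 \<and> m \<noteq> - 1 \<and> [m = r] (mod int (p ^ (k + 1))) \<longrightarrow>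
    (\<forall>\<alpha> :: complex. \<alpha> ^ (p ^ k) = of_int m \<longrightarrow> is_integral_basis \<alpha> (p ^ k) (\<lambda>i. ev (h i) \<alpha>))"
  proof (cases "int p dvd r")
    case True
    have "int p dvd m" if "[m = r] (mod int (p ^ (k + 1)))" for m
    proof -
      have "[m = r] (mod int p)" by (rule cong_dvd_modulus[OF that]) simp
      then show ?thesis using True cong_dvd_iff by blast
    qed
    then show ?thesis
      using powers_integral_basis[OF assms(1)] by (intro exI[of _ "monom 1"]) auto
  next
    case False
    \<comment> \<open>Computed from \<open>r\<close> alone, this is the maximum of \<open>0\<close>
      and \<open>k + 1 - w\<close> for every \<open>m\<close> in the residue class.\<close>
    define a0 where "a0 = (LEAST a. int p ^ (k + 1 - a) dvd r - r ^ (p ^ k))"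
    have top: "int p ^ (k + 1 - k) dvd r - r ^ (p ^ k)" unfolding add_diff_cancel_left' power_one_right by (rule frobenius_int[OF assms(1)])
    have a0: "a0 \<le> k" "int p ^ (k + 1 - a0) dvd r - r ^ (p ^ k)"
      unfolding a0_def
      using Least_le[of "\<lambda>a. int p ^ (k + 1 - a) dvd r - r ^ (p ^ k)", OF top]
        LeastI[of "\<lambda>a. int p ^ (k + 1 - a) dvd r - r ^ (p ^ k)", OF top] by blast+
    have a0': "\<not> int p ^ (k + 2 - a0) dvd r - r ^ (p ^ k)" if "a0 \<noteq> 0"
    proof -
      have eq: "k + 2 - a0 = k + 1 - (a0 - 1)" using that a0(1) by linarith
      have "a0 - 1 < (LEAST a. int p ^ (k + 1 - a) dvd r - r ^ (p ^ k))"
        unfolding a0_def[symmetric] using that by linarith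
      from not_less_Least[OF this] show ?thesis unfolding eq .
    qed
    \<comment> \<open>Exponents up to \<open>k + 1\<close> are visible modulo
      \<open>p ^ (k + 1)\<close>. The upper bound on the valuation involves
      \<open>k + 2 - a0\<close>, which is within this range exactly when \<open>a0 > 0\<close>, and
      only then is it demanded.\<close>
    have dvd: "int p ^ e dvd m - r ^ (p ^ k) \<longleftrightarrow> int p ^ e dvd r - r ^ (p ^ k)"
      if "[m = r] (mod int (p ^ (k + 1)))" "e \<le> k + 1" for m e
    proof -
      have "int p ^ e dvd int p ^ (k + 1)" using that(2) by (rule le_imp_power_dvd)
      then have "[m = r] (mod int p ^ e)" by (rule cong_dvd_modulus[OF that(1)[unfolded of_nat_power]])
      then have "[m - r ^ (p ^ k) = r - r ^ (p ^ k)] (mod int p ^ e)" by (intro cong_diff cong_refl)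
      then show ?thesis by (rule cong_dvd_iff)
    qed
    have "is_integral_basis \<alpha> (p ^ k) (\<lambda>i. ev (basis_poly p k a0 r i) \<alpha>)"
      if "squarefree m" "m \<noteq> 1" "m \<noteq> - 1" and cong: "[m = r] (mod int (p ^ (k + 1)))"
        and "\<alpha> ^ (p ^ k) = of_int m" for m \<alpha>
    proof (rule basis_poly_integral_basis[OF assms that(1-3) False a0(1) _ _ that(5)])
      show "int p ^ (k + 1 - a0) dvd m - r ^ (p ^ k)" using dvd[OF cong, of "k + 1 - a0"] a0 by simp
      show "a0 = 0 \<or> \<not> int p ^ (k + 2 - a0) dvd m - r ^ (p ^ k)"
        using dvd[OF cong, of "k + 2 - a0"] a0' by (cases "a0 = 0") auto
    qed
    then show ?thesis by (intro exI[of _ "basis_poly p k a0 r"]) blast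
  qed
qed

end
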